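(* Assume Assumption (A) holds with constants $p\ge2$, $\alpha\ge0$. Fix $T>0$ and $\rho\ge1$. There is a constant $C>0$ such that, for every $\check\delta\in(0,1]$ with $\hat\delta=\check\delta/\rho$, the ATS-TEM continuous-time approximations satisfy $$\sup_{0\le t\le T}\mathbb E|\bar Y(t)|^p\le C\quad\text{and}\quad\sup_{0\le t\le T}\mathbb E|Y(t)|^p\le C.$$ The constant $C$ may depend on $T,p,x_0,\alpha,f,g,\varphi,K,\gamma,\rho,d,m$, but not on $\check\delta$.
   Context: Probability setting: - $(\Omega,\mathcal F,\mathbb P)$ is a complete probability space with a filtration $\{\mathcal F_t\}_{t\ge0}$ satisfying the usual conditions. - $W$ is an $m$-dimensional $\{\mathcal F_t\}$-Brownian motion, and $x_0\in\mathbb{R}^d$. - $f:\mathbb{R}^d\to\mathbb{R}^d$ and $g:\mathbb{R}^d\to\mathbb{R}^{d\times m}$. - $|\cdot|$ is the Euclidean norm of vectors and the Frobenius norm of matrices. Assumption (A): (i) For every $R>0$ there is $C_R>0$ with $|f(x)-f(y)|+|g(x)-g(y)|\le C_R|x-y|$ whenever $|x|\vee|y|\le R$. (ii) There exist $p\ge2$ and $\alpha\ge0$ with $\langle x,f(x)\rangle+\frac{p-1}{2}|g(x)|^2\le\alpha(1+|x|^2)$ for all $x$. Auxiliary objects: - Fix a strictly increasing continuous function $\varphi:[0,\infty)\to[1,\infty)$ with $\varphi(r)\to\infty$ and $\sup_{|x|\le r}\big(\frac{|f(x)|}{1+|x|}\vee\frac{|g(x)|^2}{(1+|x|)^2}\big)\le\varphi(r)$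 for all $r>0$; let $\varphi^{-1}$ be its inverse. - Fix $0<\hat\delta\le\check\delta\le1$, $\gamma\in(0,1/3]$ and $K\ge\varphi(1)$. - Define $\delta(x)=\max\{\hat\delta,\check\delta/\varphi(|x|)\}$. - Define $\pi_{\hat\delta}(x)=(|x|\wedge\varphi^{-1}(K\hat\delta^{-\gamma}))x/|x|$, with $\pi_{\hat\delta}(0)=0$. - Define $F(x)=f(x)$ if $\delta(x)>\hat\delta$ and $F(x)=f(\pi_{\hat\delta}(x))$ if $\delta(x)=\hat\delta$; define $G$ analogously with $g$. ATS-TEM scheme: $Y_{t_0}=x_0$, $t_0=0$, and for $n\ge0$, $$\delta_n=\delta(Y_{t_n}),\quad t_{n+1}=t_n+\delta_n,\quad Y_{t_{n+1}}=Y_{t_n}+F(Y_{t_n})\delta_n+G(Y_{t_n})(W(t_{n+1})-W(t_n)).$$ Continuous-time approximations: let $n_t=\max\{n:t_n\le t\}$ and $\bar Y(t)=Y_{t_{n_t}}$, and $$Y(t)=x_0+\int_0^tF(\bar Y(s))\,ds+\int_0^tG(\bar Y(s))\,dW(s),\qquad t\ge0.$$ *)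

theory Defs
  imports "HOL-Analysis.Analysis" "HOL-Probability.Probability"
begin

definition filtration_on :: "'a measure \<Rightarrow> (real \<Rightarrow> 'a measure) \<Rightarrow> bool" where
  "filtration_on M F \<longleftrightarrow> (\<forall>t\<ge>0. subalgebra M (F t)) \<and>
      (\<forall>s t. 0 \<le> s \<and> s \<le> t \<longrightarrow> sets (F s) \<subseteq> sets (F t))"

definition brownian_motion :: "'a measure \<Rightarrow> (real \<Rightarrow> 'a measure) \<Rightarrow> (real \<Rightarrow> 'a \<Rightarrow> real^'m) \<Rightarrow> bool" where
  "brownian_motion M F W \<longleftrightarrow>
     prob_space M \<and> filtration_on M F \<and>
     (\<forall>t\<ge>0. W t \<in> borel_measurable (F t)) \<and>
     (\<forall>\<omega>\<in>space M. W 0 \<omega> = 0 \<and> continuous_on {0..} (\<lambda>t. W t \<omega>)) \<and>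
     (\<forall>s t. 0 \<le> s \<and> s < t \<longrightarrow>
        distributed M lborel (\<lambda>\<omega>. W t \<omega> - W s \<omega>)
          (\<lambda>x. \<Prod>j\<in>UNIV. ennreal (normal_density 0 (sqrt (t - s)) (x $ j))) \<and>
        prob_space.indep_set M (sets (F s))
          {(\<lambda>\<omega>. W t \<omega> - W s \<omega>) -` A \<inter> space M | A. A \<in> sets borel})"

definition ats_delta :: "(real \<Rightarrow> real) \<Rightarrow> real \<Rightarrow> real \<Rightarrow> real^'d \<Rightarrow> real" where
  "ats_delta \<phi> dh dc x = max dh (dc / \<phi> (norm x))"

definition ats_proj :: "(real \<Rightarrow> real) \<Rightarrow> real \<Rightarrow> real \<Rightarrow> real \<Rightarrow> real^'d \<Rightarrow> real^'d" where
  "ats_proj \<phi> K \<gamma> dh x =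
     (if x = 0 then 0
      else (min (norm x) (the_inv_into {0..} \<phi> (K * dh powr (- \<gamma>))) / norm x) *\<^sub>R x)"

definition ats_coef :: "(real \<Rightarrow> real) \<Rightarrow> real \<Rightarrow> real \<Rightarrow> real \<Rightarrow> real \<Rightarrow> (real^'d \<Rightarrow> 'b) \<Rightarrow> real^'d \<Rightarrow> 'b" where
  "ats_coef \<phi> K \<gamma> dh dc h x =
     (if ats_delta \<phi> dh dc x > dh then h x else h (ats_proj \<phi> K \<gamma> dh x))"

primrec ats_seq :: "(real^'d \<Rightarrow> real) \<Rightarrow> (real^'d \<Rightarrow> real^'d) \<Rightarrow> (real^'d \<Rightarrow> real^'m^'d) \<Rightarrow> real^'d
     \<Rightarrow> (real \<Rightarrow> 'a \<Rightarrow> real^'m) \<Rightarrow> 'a \<Rightarrow> nat \<Rightarrow> real \<times> (real^'d)" where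
  "ats_seq \<Delta> Fc Gc x0 W \<omega> 0 = (0, x0)"
| "ats_seq \<Delta> Fc Gc x0 W \<omega> (Suc n) =
     (let tn = fst (ats_seq \<Delta> Fc Gc x0 W \<omega> n); yn = snd (ats_seq \<Delta> Fc Gc x0 W \<omega> n);
          h = \<Delta> yn
      in (tn + h, yn + h *\<^sub>R Fc yn + Gc yn *v (W (tn + h) \<omega> - W tn \<omega>)))"

definition ats_index :: "(real^'d \<Rightarrow> real) \<Rightarrow> (real^'d \<Rightarrow> real^'d) \<Rightarrow> (real^'d \<Rightarrow> real^'m^'d) \<Rightarrow> real^'d
     \<Rightarrow> (real \<Rightarrow> 'a \<Rightarrow> real^'m) \<Rightarrow> real \<Rightarrow> 'a \<Rightarrow> nat" where
  "ats_index \<Delta> Fc Gc x0 W t \<omega> = Max {n. fst (ats_seq \<Delta> Fc Gc x0 W \<omega> n) \<le> t}"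

definition ats_Ybar :: "(real^'d \<Rightarrow> real) \<Rightarrow> (real^'d \<Rightarrow> real^'d) \<Rightarrow> (real^'d \<Rightarrow> real^'m^'d) \<Rightarrow> real^'d
     \<Rightarrow> (real \<Rightarrow> 'a \<Rightarrow> real^'m) \<Rightarrow> real \<Rightarrow> 'a \<Rightarrow> real^'d" where
  "ats_Ybar \<Delta> Fc Gc x0 W t \<omega> = snd (ats_seq \<Delta> Fc Gc x0 W \<omega> (ats_index \<Delta> Fc Gc x0 W t \<omega>))"

text \<open>Continuous approximation Y(t) = x0 + int_0^t F(bar Y) ds + int_0^t G(bar Y) dW; since bar Y is
 piecewise constant on [t_n, t_{n+1}), both integrals are evaluated pathwise, which gives
 Y(t) = Y_{t_{n_t}} + F(Y_{t_{n_t}})(t - t_{n_t}) + G(Y_{t_{n_t}})(W t - W t_{n_t}).\<close>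
definition ats_Y :: "(real^'d \<Rightarrow> real) \<Rightarrow> (real^'d \<Rightarrow> real^'d) \<Rightarrow> (real^'d \<Rightarrow> real^'m^'d) \<Rightarrow> real^'d
     \<Rightarrow> (real \<Rightarrow> 'a \<Rightarrow> real^'m) \<Rightarrow> real \<Rightarrow> 'a \<Rightarrow> real^'d" where
  "ats_Y \<Delta> Fc Gc x0 W t \<omega> =
     (let n = ats_index \<Delta> Fc Gc x0 W t \<omega>; tn = fst (ats_seq \<Delta> Fc Gc x0 W \<omega> n);
          yn = snd (ats_seq \<Delta> Fc Gc x0 W \<omega> n)
      in yn + (t - tn) *\<^sub>R Fc yn + Gc yn *v (W t \<omega> - W tn \<omega>))"

end

theory Submission
  imports Defs
begin

text \<open>
  Let \<open>V y\<close> be the \<open>p/2\<close>-th power of \<open>1 + |y|\<^sup>2\<close>. A third-order Taylor bound for \<open>V\<close>, integrated against a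
  centred Gaussian increment \<open>Z\<close> of variance \<open>u\<close>, gives \<open>E V (y + u F y + G y Z) \<le> (1 + \<lambda> u) V y\<close> for
  \<open>0 < u \<le> \<delta> y\<close>: the Khasminskii condition controls the terms of second order, and the remainder is \<open>O(u)\<close>
  because \<open>|G y| / (1 + |y|)\<close> is at most a constant times \<open>u\<close> to the power \<open>-1/6\<close>. This is where
  \<open>\<gamma> \<le> 1/3\<close> enters; where the step is larger than the minimal one, \<open>\<phi> |y| < \<rho>\<close> and the growth is linear anyway.
  Hence \<open>exp (- \<lambda> t\<^sub>n) V (Y\<^sub>n)\<close> has nonincreasing expectation for every scheme whose step length is a
  function of the current time and state bounded by \<open>\<delta>\<close>. Both continuous-time approximations at
  time \<open>t\<close> are such schemes: shorten the step that crosses \<open>t\<close> so that it ends at \<open>t\<close> (for \<open>Y\<close>), or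
  replace it by a step of length 0 (for the step process).
\<close>

subsection \<open>Taylor bounds\<close>

text \<open>Khasminskii's condition bounds only a sum whose terms may have either sign, so the first
  and second moments of the Gaussian part have to be computed exactly, and the squared increment
  must carry the coefficient \<open>p * (p - 1) / 2\<close>, which is \<open>p\<close> times the
  \<open>(p - 1) / 2\<close> of the condition. Only beyond second order is there room for crude
  constants. The truncated coefficients are evaluated at a point of the segment from 0 to
  \<open>y\<close>, so they inherit the condition, with a doubled constant. The rate \<lambda> comes
  from \<open>p\<close>, \<alpha>, \<open>K + \<rho>\<close> and the dimensions, never from the step
  sizes. The number of steps does depend on them, but no step raises the discounted expectation, so
  nothing accumulates. The obstacle is probabilistic: the time grid is random, while the increments
  are assumed independent of the past at deterministic times only. Integrals of nonnegative
  functions are used for the expectations of the scheme, so that no moment need be known to be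
  finite in advance.\<close>

lemma one_plus_powr_le_Taylor2:
  fixes q :: real
  assumes q: "q \<ge> 1"
  obtains C :: real and n :: nat where "C \<ge> 0" "n \<ge> 3"
    "\<And>x. x \<ge> -1 \<Longrightarrow> (1 + x) powr q \<le> 1 + q * x + q * (q - 1) / 2 * x\<^sup>2 + C * (\<bar>x\<bar>^3 + \<bar>x\<bar>^n)"
proof -
  obtain n0 :: nat where n0: "q \<le> real n0" using real_arch_simple by blast
  \<comment> \<open>Two powers are needed: the cube is the order of the remainder near 0, while a
    power at least \<open>q\<close> has to dominate for large \<open>x\<close>.\<close>
  define n where "n = max 3 n0"
  have n: "n \<ge> 3" "q \<le> real n" using n0 by (auto simp: n_def)
  define C1 where "C1 = \<bar>q * (q - 1) * (q - 2)\<bar> * 2 powr \<bar>q - 3\<bar>"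
  define C where "C = C1 + 3 ^ n + 4 * q"
  have C1: "C1 \<ge> 0" by (simp add: C1_def)
  have C0: "C \<ge> 0" using q C1 by (simp add: C_def)
  have "(1 + x) powr q \<le> 1 + q * x + q * (q - 1) / 2 * x\<^sup>2 + C * (\<bar>x\<bar>^3 + \<bar>x\<bar>^n)" if x: "x \<ge> -1" for x
  proof (cases "\<bar>x\<bar> \<le> 1/2")
    case small: True
    show ?thesis
    proof (cases "x = 0")
      case True then show ?thesis using n C0 by simp
    next
      case False
      define diff where "diff = (\<lambda>m t :: real. (\<Prod>i<m. q - real i) * t powr (q - real m))"
      have "\<exists>t. (if 1 + x < 1 then 1 + x < t \<and> t < 1 else 1 < t \<and> t < 1 + x) \<and>
          (1 + x) powr q = (\<Sum>m<3. diff m 1 / fact m * (1 + x - 1) ^ m) + diff 3 t / fact 3 * (1 + x - 1) ^ 3"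
      proof (rule MacLaurin.Taylor[where a = "1/2" and b = "3/2"])
        show "\<forall>m t. m < 3 \<and> 1 / 2 \<le> t \<and> t \<le> 3 / 2 \<longrightarrow> DERIV (diff m) t :> diff (Suc m) t"
          unfolding diff_def by (auto intro!: derivative_eq_intros simp: algebra_simps)
      qed (use small False in \<open>auto simp: diff_def\<close>)
      then obtain t where t: "if 1 + x < 1 then 1 + x < t \<and> t < 1 else 1 < t \<and> t < 1 + x"
        and eq: "(1 + x) powr q = (\<Sum>m<3. diff m 1 / fact m * (1 + x - 1) ^ m) + diff 3 t / fact 3 * (1 + x - 1) ^ 3"
        by blast
      have t2: "1/2 < t" "t < 2" using t small by (auto split: if_splits)
      \<comment> \<open>The intermediate point lies between 1/2 and 2. The power is monotone in
        \<open>t\<close>, increasing or decreasing with the sign of \<open>q - 3\<close>, and the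
        endpoint that decides gives the same bound in both cases.\<close>
      have tp: "t powr (q - 3) \<le> 2 powr \<bar>q - 3\<bar>"
      proof (cases "q \<ge> 3")
        case True then show ?thesis using t2 by (auto intro!: powr_mono2)
      next
        case False
        have "t powr (q - 3) \<le> (1/2) powr (q - 3)" using False t2 by (intro powr_mono2') auto
        also have "\<dots> = 2 powr \<bar>q - 3\<bar>" using False
          by (simp add: powr_divide powr_minus[symmetric] powr_minus_divide[symmetric])
        finally show ?thesis .
      qed
      have "\<bar>diff 3 t\<bar> \<le> C1"
        unfolding diff_def C1_def abs_mult using tp
        by (intro mult_mono) (auto simp: lessThan_Suc numeral_3_eq_3 abs_mult mult_ac)
      then have "diff 3 t / fact 3 * x ^ 3 \<le> C1 * \<bar>x\<bar>^3"
      proof -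
        have "diff 3 t / fact 3 * x ^ 3 \<le> \<bar>diff 3 t / fact 3 * x ^ 3\<bar>" by (rule abs_ge_self)
        also have "\<dots> = \<bar>diff 3 t\<bar> / 6 * \<bar>x\<bar>^3"
          by (simp add: abs_mult power_abs fact_numeral)
        also have "\<dots> \<le> C1 * \<bar>x\<bar>^3"
          using \<open>\<bar>diff 3 t\<bar> \<le> C1\<close> by (intro mult_right_mono) auto
        finally show ?thesis .
      qed
      moreover have "(\<Sum>m<3. diff m 1 / fact m * x ^ m) = 1 + q * x + q * (q - 1) / 2 * x\<^sup>2"
        by (simp add: diff_def numeral_3_eq_3 lessThan_Suc power2_eq_square)
      moreover have "C1 * \<bar>x\<bar>^3 \<le> C * (\<bar>x\<bar>^3 + \<bar>x\<bar>^n)"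
        using C1 q by (intro mult_mono) (auto simp: C_def)
      ultimately show ?thesis using eq by simp
    qed
  next
    case False
    then have x2: "1 \<le> 2 * \<bar>x\<bar>" by simp
    have "(1 + x) powr q \<le> (1 + \<bar>x\<bar>) powr q" using q x by (intro powr_mono2) auto
    also have "\<dots> \<le> (1 + \<bar>x\<bar>) powr (real n)" using n by (intro powr_mono) auto
    also have "\<dots> = (1 + \<bar>x\<bar>) ^ n" by (subst powr_realpow) auto
    also have "\<dots> \<le> (3 * \<bar>x\<bar>) ^ n" using x2 by (intro power_mono) auto
    finally have 1: "(1 + x) powr q \<le> 3 ^ n * \<bar>x\<bar> ^ n" by (simp add: power_mult_distrib)
    have "1 * \<bar>x\<bar> \<le> (2 * \<bar>x\<bar>)\<^sup>2 * \<bar>x\<bar>"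
      using x2 by (intro mult_right_mono one_le_power) auto
    then have "q * \<bar>x\<bar> \<le> q * (4 * \<bar>x\<bar>^3)" using q
      by (intro mult_left_mono) (auto simp: power2_eq_square power3_eq_cube)
    moreover have "- (q * x) \<le> q * \<bar>x\<bar>" using q abs_le_iff mult_left_mono[of "-x" "\<bar>x\<bar>" q] by auto
    ultimately have 2: "- (q * x) \<le> 4 * q * \<bar>x\<bar>^3" by simp
    have 3: "0 \<le> q * (q - 1) / 2 * x\<^sup>2" using q by simp
    have 4: "0 \<le> C1 * (\<bar>x\<bar>^3 + \<bar>x\<bar>^n) + 3 ^ n * \<bar>x\<bar>^3 + 4 * q * \<bar>x\<bar>^n" using C1 q by simp
    have 5: "C * (\<bar>x\<bar>^3 + \<bar>x\<bar>^n) = (C1 * (\<bar>x\<bar>^3 + \<bar>x\<bar>^n) + 3 ^ n * \<bar>x\<bar>^3 + 4 * q * \<bar>x\<bar>^n)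
        + 3 ^ n * \<bar>x\<bar>^n + 4 * q * \<bar>x\<bar>^3"
      unfolding C_def by (simp add: algebra_simps)
    show ?thesis using 1 2 3 4 5 by linarith
  qed
  then show ?thesis using that[of C n] C0 n by blast
qed

lemma power_le_power3_plus_power:
  fixes w :: real
  assumes "w \<ge> 0" "3 \<le> j" "j \<le> N"
  shows "w ^ j \<le> w ^ 3 + w ^ N"
proof (cases "w \<le> 1")
  case True
  then have "w ^ j \<le> w ^ 3" using assms by (intro power_decreasing) auto
  then show ?thesis using assms by (simp add: add_increasing2)
next
  case False
  then have "w ^ j \<le> w ^ N" using assms by (intro power_increasing) auto
  then show ?thesis using assms by (simp add: add_increasing)
qed

text \<open>Factor out \<open>v = 1 + |y|\<^sup>2\<close> and apply the scalar bound to the relative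
  change \<open>x = (2 * inner y z + |z|\<^sup>2) / v\<close>. By Cauchy-Schwarz the square of
  \<open>inner y z\<close> costs at most \<open>v * |z|\<^sup>2\<close>, which turns the
  second-order coefficients \<open>p / 2\<close> and \<open>p * (p - 2) / 2\<close> into their sum
  \<open>p * (p - 1) / 2\<close>. The linear term is left untouched, since its Gaussian part will
  average to 0 and its drift part is needed with its sign.\<close>

lemma one_plus_norm_square_powr_le_Taylor2:
  fixes p :: real
  assumes p: "p \<ge> 2"
  obtains C :: real and n :: nat where "C \<ge> 0" "n \<ge> 3"
    "\<And>y z :: 'v :: real_inner. (1 + (norm (y + z))\<^sup>2) powr (p / 2) \<le> (1 + (norm y)\<^sup>2) powr (p / 2) *
       (1 + (p * inner y z + p * (p - 1) / 2 * (norm z)\<^sup>2) / (1 + (norm y)\<^sup>2)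
         + C * ((norm z / sqrt (1 + (norm y)\<^sup>2)) ^ 3 + (norm z / sqrt (1 + (norm y)\<^sup>2)) ^ (2 * n)))"
proof -
  have "p / 2 \<ge> 1" using p by simp
  then obtain C0 :: real and n :: nat where C0: "C0 \<ge> 0" and n: "n \<ge> 3"
    and T: "\<And>x. x \<ge> -1 \<Longrightarrow> (1 + x) powr (p/2) \<le> 1 + p/2 * x + p/2 * (p/2 - 1) / 2 * x\<^sup>2 + C0 * (\<bar>x\<bar>^3 + \<bar>x\<bar>^n)"
    using one_plus_powr_le_Taylor2 by blast
  define C where "C = 5 * (p/2 * (p/2 - 1) / 2) + C0 * (2 * 3^3 + 2 * 3^n)"
  have "C \<ge> 0" using C0 p by (simp add: C_def)
  moreover have "(1 + (norm (y + z))\<^sup>2) powr (p / 2) \<le> (1 + (norm y)\<^sup>2) powr (p / 2) *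
       (1 + (p * inner y z + p * (p - 1) / 2 * (norm z)\<^sup>2) / (1 + (norm y)\<^sup>2)
         + C * ((norm z / sqrt (1 + (norm y)\<^sup>2)) ^ 3 + (norm z / sqrt (1 + (norm y)\<^sup>2)) ^ (2 * n)))"
    for y z :: 'v
  proof -
    define v where "v = 1 + (norm y)\<^sup>2"
    have v: "v \<ge> 1" by (simp add: v_def)
    define w where "w = norm z / sqrt v"
    define b where "b = inner y z / v"
    define x where "x = 2 * b + w\<^sup>2"
    have w0: "w \<ge> 0" using v by (simp add: w_def)
    have w2: "w\<^sup>2 = (norm z)\<^sup>2 / v" using v by (simp add: w_def power_divide)
    have xv: "1 + (norm (y + z))\<^sup>2 = v * (1 + x)"
    proof -
      have "(norm (y + z))\<^sup>2 = (norm y)\<^sup>2 + 2 * inner y z + (norm z)\<^sup>2"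
        by (simp add: power2_norm_eq_inner inner_add inner_commute)
      then show ?thesis using v by (simp add: x_def b_def w2 distrib_left) (simp add: v_def)
    qed
    have x1: "x \<ge> -1"
    proof -
      have "0 \<le> v * (1 + x)" using xv[symmetric] by simp
      then show ?thesis using v by (simp add: zero_le_mult_iff)
    qed
    have byw: "\<bar>b\<bar> \<le> w"
    proof -
      have "\<bar>inner y z\<bar> \<le> norm y * norm z" by (rule Cauchy_Schwarz_ineq2)
      also have "\<dots> \<le> sqrt v * norm z"
        by (intro mult_right_mono) (auto simp: v_def real_le_rsqrt)
      finally have "\<bar>b\<bar> \<le> sqrt v * norm z / v" using v by (simp add: b_def divide_right_mono)
      also have "\<dots> = w" using v by (simp add: w_def real_div_sqrt field_simps)
      finally show ?thesis .
    qed
    have b2: "b\<^sup>2 \<le> w\<^sup>2" using byw w0 by (simp add: abs_le_square_iff[symmetric])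
    have xa: "\<bar>x\<bar> \<le> 2 * w + w\<^sup>2" using byw w0 unfolding x_def
      by (smt (verit) zero_le_power2)
    have N3: "2 * n \<ge> 4" using n by simp
    define E where "E = w ^ 3 + w ^ (2 * n)"
    have E0: "E \<ge> 0" using w0 by (simp add: E_def)
    \<comment> \<open>Since \<open>x\<close> mixes \<open>w\<close> and its square, its
      \<open>j\<close>-th power ranges over exponents from \<open>j\<close> to \<open>2 * j\<close>.
      This is why the upper exponent doubles to \<open>2 * n\<close>; being even, it also gives an
      elementary Gaussian moment later.\<close>
    have xp: "\<bar>x\<bar> ^ j \<le> 2 * 3 ^ j * E" if "3 \<le> j" "j \<le> n" for j
    proof -
      have "\<bar>x\<bar> \<le> 3 * max w (w\<^sup>2)" using xa w0 by auto
      then have "\<bar>x\<bar> ^ j \<le> (3 * max w (w\<^sup>2)) ^ j" by (intro power_mono) auto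
      also have "\<dots> = 3 ^ j * max w (w\<^sup>2) ^ j" by (simp add: power_mult_distrib)
      also have "max w (w\<^sup>2) ^ j \<le> w ^ j + w ^ (2 * j)"
        using w0 by (auto simp: max_def power_mult)
      also have "w ^ j + w ^ (2 * j) \<le> 2 * E"
        using power_le_power3_plus_power[OF w0, of j "2 * n"] power_le_power3_plus_power[OF w0, of "2*j" "2 * n"] that
        by (simp add: E_def)
      finally show ?thesis by simp
    qed
    \<comment> \<open>The quadratic part \<open>4 * w\<^sup>2\<close> has to be sharp, as it
      contributes to \<open>p * (p - 1) / 2\<close>; the mixed and quartic parts are at least cubic
      in \<open>w\<close> and go into \<open>E\<close>.\<close>
    have x2: "x\<^sup>2 \<le> 4 * w\<^sup>2 + 5 * E"
    proof -
      have "x\<^sup>2 = 4 * b\<^sup>2 + 4 * b * w\<^sup>2 + w ^ 4"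
        by (simp add: x_def power2_eq_square power4_eq_xxxx algebra_simps)
      moreover have "b * w\<^sup>2 \<le> w * w\<^sup>2" using byw by (intro mult_right_mono) auto
      moreover have "w * w\<^sup>2 = w ^ 3" by (simp add: power2_eq_square power3_eq_cube)
      moreover have "w ^ 3 \<le> E" "w ^ 4 \<le> E"
        using power_le_power3_plus_power[OF w0, of 3 "2 * n"] power_le_power3_plus_power[OF w0, of 4 "2 * n"] N3
        by (auto simp: E_def)
      ultimately show ?thesis using b2 by linarith
    qed
    have "(1 + x) powr (p/2) \<le> 1 + p/2 * x + p/2 * (p/2 - 1) / 2 * x\<^sup>2 + C0 * (\<bar>x\<bar>^3 + \<bar>x\<bar>^n)"
      by (rule T[OF x1])
    also have "\<dots> \<le> 1 + p/2 * x + p/2 * (p/2 - 1) / 2 * (4 * w\<^sup>2 + 5 * E) + C0 * (2 * 3^3 * E + 2 * 3^n * E)"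
      using x2 xp[of 3] xp[of n] n C0 p by (intro add_mono mult_left_mono) auto
    also have "\<dots> = 1 + (p * b + p * (p - 1) / 2 * w\<^sup>2) + C * E"
      by (simp add: C_def x_def field_simps power2_eq_square)
    finally have "(1 + x) powr (p/2) \<le> 1 + (p * b + p * (p - 1) / 2 * w\<^sup>2) + C * E" .
    then have "v powr (p/2) * (1 + x) powr (p/2) \<le> v powr (p/2) * (1 + (p * b + p * (p - 1) / 2 * w\<^sup>2) + C * E)"
      by (intro mult_left_mono) auto
    moreover have "p * b + p * (p - 1) / 2 * w\<^sup>2 = (p * inner y z + p * (p - 1) / 2 * (norm z)\<^sup>2) / v"
      by (simp add: w2 b_def add_divide_distrib)
    ultimately show ?thesis
      using x1 v unfolding xv by (simp add: powr_mult E_def w_def v_def)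
  qed
  ultimately show ?thesis using that n by blast
qed

subsection \<open>Isotropic Gaussian measures\<close>

text \<open>The centred normal law with covariance \<open>u\<close> times the identity. The density
  is written as in \<open>brownian_motion\<close>, so that the increments have this law by
  definition.\<close>

definition iso_gauss :: "real \<Rightarrow> (real^'m) measure" where
  "iso_gauss u = density lborel (\<lambda>x. \<Prod>j\<in>UNIV. ennreal (normal_density 0 (sqrt u) (x $ j)))"

lemma sets_iso_gauss [simp, measurable_cong]: "sets (iso_gauss u) = sets borel"
  and space_iso_gauss [simp]: "space (iso_gauss u) = UNIV"
  by (simp_all add: iso_gauss_def)

text \<open>Lebesgue measure on \<open>real^'m\<close> is the image of a product measure indexed by
  basis vectors. Fubini's theorem applies there once each coordinate \<open>j\<close> is identified
  with the vector \<open>axis j 1\<close>; \<open>i\<close> is the inverse of that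
  identification.\<close>

lemma has_bochner_integral_lborel_prod:
  fixes h :: "'m::finite \<Rightarrow> real \<Rightarrow> real"
  assumes "\<And>j. has_bochner_integral lborel (h j) (c j)"
  shows "has_bochner_integral lborel (\<lambda>x :: real^'m. \<Prod>j\<in>UNIV. h j (x $ j)) (\<Prod>j\<in>UNIV. c j)"
proof -
  interpret product_sigma_finite "\<lambda>_ :: real^'m. lborel :: real measure" ..
  define i where "i = (\<lambda>b :: real^'m. SOME j. b = axis j 1)"
  have i: "i (axis j 1) = j" for j
    unfolding i_def by (rule some_equality) (auto simp: axis_eq_axis)
  define h' where "h' = (\<lambda>b. h (i b))"
  have inj: "inj (\<lambda>j. axis j (1 :: real) :: real^'m)" by (auto simp: inj_on_def axis_eq_axis)
  have Basis_eq: "(Basis :: (real^'m) set) = range (\<lambda>j. axis j 1)" by (auto simp: Basis_vec_def)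
  have prod_eq: "(\<Prod>b\<in>(Basis :: (real^'m) set). g b) = (\<Prod>j\<in>UNIV. g (axis j 1))" for g :: "real^'m \<Rightarrow> real"
    unfolding Basis_eq by (subst prod.reindex[OF inj]) simp
  have hb: "integrable lborel (h' b)" "integral\<^sup>L lborel (h' b) = c (i b)" for b
    using assms[of "i b"] by (auto simp: h'_def has_bochner_integral_iff)
  have [measurable]: "h j \<in> borel_measurable borel" for j
    using assms[of j] by (auto simp: has_bochner_integral_iff)
  have comp: "(\<Sum>b\<in>Basis. x b *\<^sub>R b) $ j = x (axis j 1)" for x :: "real^'m \<Rightarrow> real" and j
  proof -
    have "(\<Sum>b\<in>Basis. x b *\<^sub>R b) $ j = (\<Sum>b\<in>Basis. x b *\<^sub>R b) \<bullet> axis j 1"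
      by (simp add: inner_axis)
    also have "\<dots> = x (axis j 1)" by (rule inner_sum_left_Basis) simp
    finally show ?thesis .
  qed
  have "has_bochner_integral (\<Pi>\<^sub>M b\<in>(Basis :: (real^'m) set). lborel)
      (\<lambda>x. \<Prod>b\<in>Basis. h' b (x b)) (\<Prod>b\<in>Basis. c (i b))"
    using hb by (auto simp: has_bochner_integral_iff intro!: product_integrable_prod)
       (subst product_integral_prod, auto)
  then have "has_bochner_integral (\<Pi>\<^sub>M b\<in>(Basis :: (real^'m) set). lborel)
      (\<lambda>x. \<Prod>j\<in>UNIV. h j ((\<Sum>b\<in>Basis. x b *\<^sub>R b :: real^'m) $ j)) (\<Prod>j\<in>UNIV. c j)"
    unfolding comp prod_eq by (simp add: h'_def i)
  then show ?thesis
    unfolding lborel_eq[where 'a = "real^'m"]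
    by (subst has_bochner_integral_distr) auto
qed

text \<open>The source of all exact moments below: choose a monomial in the coordinates involved and
  the constant 1 in all others.\<close>

lemma has_bochner_integral_iso_gauss_prod:
  fixes h :: "'m::finite \<Rightarrow> real \<Rightarrow> real"
  assumes "\<And>j. has_bochner_integral lborel (\<lambda>x. normal_density 0 (sqrt u) x * h j x) (c j)"
    and [measurable]: "\<And>j. h j \<in> borel_measurable borel"
  shows "has_bochner_integral (iso_gauss u) (\<lambda>x :: real^'m. \<Prod>j\<in>UNIV. h j (x $ j)) (\<Prod>j\<in>UNIV. c j)"
proof -
  have eq: "iso_gauss u = density lborel (\<lambda>x :: real^'m. ennreal (\<Prod>j\<in>UNIV. normal_density 0 (sqrt u) (x $ j)))"
    unfolding iso_gauss_def by (subst prod_ennreal) auto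
  show ?thesis unfolding eq
    using has_bochner_integral_lborel_prod[of "\<lambda>j x. normal_density 0 (sqrt u) x * h j x" c, OF assms(1)]
    by (intro has_bochner_integral_density) (auto simp: prod.distrib intro!: prod_nonneg)
qed

text \<open>The norm is at most the sum of the absolute coordinates, hence at most the dimension
  times the largest one. The crude factor ends up only in the constant of the remainder.\<close>

lemma norm_power_le_sum:
  fixes x :: "real^'m"
  shows "norm x ^ n \<le> real CARD('m) ^ n * (\<Sum>i\<in>UNIV. \<bar>x $ i\<bar> ^ n)"
proof -
  obtain k where k: "\<And>i. \<bar>x $ i\<bar> \<le> \<bar>x $ k\<bar>"
  proof -
    have "Max (range (\<lambda>i. \<bar>x $ i\<bar>)) \<in> range (\<lambda>i. \<bar>x $ i\<bar>)" by (rule Max_in) auto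
    then obtain k where "Max (range (\<lambda>i. \<bar>x $ i\<bar>)) = \<bar>x $ k\<bar>" by (rule imageE)
    moreover have "\<bar>x $ i\<bar> \<le> Max (range (\<lambda>i. \<bar>x $ i\<bar>))" for i by (rule Max_ge) auto
    ultimately show ?thesis using that[of k] by simp
  qed
  have "norm x \<le> (\<Sum>i\<in>UNIV. \<bar>x $ i\<bar>)" by (rule norm_le_l1_cart)
  also have "\<dots> \<le> real CARD('m) * \<bar>x $ k\<bar>" using sum_bounded_above[of UNIV "\<lambda>i. \<bar>x $ i\<bar>" "\<bar>x $ k\<bar>"] k by simp
  finally have "norm x ^ n \<le> (real CARD('m) * \<bar>x $ k\<bar>) ^ n" by (intro power_mono) auto
  also have "\<dots> = real CARD('m) ^ n * \<bar>x $ k\<bar> ^ n" by (simp add: power_mult_distrib)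
  also have "\<dots> \<le> real CARD('m) ^ n * (\<Sum>i\<in>UNIV. \<bar>x $ i\<bar> ^ n)"
    by (intro mult_left_mono member_le_sum) auto
  finally show ?thesis .
qed

context
  fixes u :: real assumes u: "u > 0"
begin

lemma normal_moments:
  shows "has_bochner_integral lborel (\<lambda>x. normal_density 0 (sqrt u) x * 1) 1"
    "has_bochner_integral lborel (\<lambda>x. normal_density 0 (sqrt u) x * x) 0"
    "has_bochner_integral lborel (\<lambda>x. normal_density 0 (sqrt u) x * x\<^sup>2) u"
    "has_bochner_integral lborel (\<lambda>x. normal_density 0 (sqrt u) x * x ^ (2 * n)) (fact (2 * n) / (2 ^ n * fact n) * u ^ n)"
proof -
  have s: "sqrt u > 0" using u by simp
  show "has_bochner_integral lborel (\<lambda>x. normal_density 0 (sqrt u) x * 1) 1"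
    using normal_moment_even[OF s, of 0 0] by simp
  show "has_bochner_integral lborel (\<lambda>x. normal_density 0 (sqrt u) x * x) 0"
    using normal_moment_odd[OF s, of 0 0] by simp
  show "has_bochner_integral lborel (\<lambda>x. normal_density 0 (sqrt u) x * x\<^sup>2) u"
    using normal_moment_even[OF s, of 0 1] u by simp
  show "has_bochner_integral lborel (\<lambda>x. normal_density 0 (sqrt u) x * x ^ (2 * n)) (fact (2 * n) / (2 ^ n * fact n) * u ^ n)"
    using normal_moment_even[OF s, of 0 n] u by (simp add: power_divide)
qed

lemma prob_space_iso_gauss: "prob_space (iso_gauss u :: (real^'m) measure)"
proof -
  have "has_bochner_integral (iso_gauss u) (\<lambda>x :: real^'m. \<Prod>j\<in>(UNIV :: 'm set). (1 :: real)) (\<Prod>j\<in>(UNIV :: 'm set). 1)"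
    by (rule has_bochner_integral_iso_gauss_prod[where h = "\<lambda>_ _. 1" and c = "\<lambda>_. 1"]) (use normal_moments(1) in auto)
  then have *: "has_bochner_integral (iso_gauss u) (\<lambda>x :: real^'m. 1 :: real) 1" by simp
  then have "(\<integral>\<^sup>+ x. ennreal 1 \<partial>(iso_gauss u :: (real^'m) measure)) = ennreal 1"
    unfolding has_bochner_integral_iff by (subst nn_integral_eq_integral) auto
  then show ?thesis by (intro prob_spaceI) simp
qed

lemma has_bochner_integral_iso_gauss_component:
  "has_bochner_integral (iso_gauss u) (\<lambda>x :: real^'m. x $ i) 0"
proof -
  have "has_bochner_integral (iso_gauss u) (\<lambda>x :: real^'m. \<Prod>j\<in>UNIV. (if j = i then \<lambda>y. y else (\<lambda>_. 1)) (x $ j))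
     (\<Prod>j\<in>(UNIV :: 'm set). if j = i then 0 else 1)"
    by (rule has_bochner_integral_iso_gauss_prod) (use normal_moments(1,2) in auto)
  moreover have "(\<Prod>j\<in>UNIV. (if j = i then \<lambda>y. y else (\<lambda>_. 1)) (x $ j)) = x $ i" for x :: "real^'m"
    using prod.delta[of UNIV i "\<lambda>j. x $ j"] by (simp add: if_distribR cong: if_cong)
  ultimately show ?thesis by (simp add: prod.delta)
qed

lemma has_bochner_integral_iso_gauss_component2:
  "has_bochner_integral (iso_gauss u) (\<lambda>x :: real^'m. x $ i * x $ k) (if i = k then u else 0)"
proof (cases "i = k")
  case True
  have "has_bochner_integral (iso_gauss u) (\<lambda>x :: real^'m. \<Prod>j\<in>UNIV. (if j = i then \<lambda>y. y\<^sup>2 else (\<lambda>_. 1)) (x $ j))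
     (\<Prod>j\<in>(UNIV :: 'm set). if j = i then u else 1)"
    by (rule has_bochner_integral_iso_gauss_prod) (use normal_moments(1,3) in auto)
  moreover have "(\<Prod>j\<in>UNIV. (if j = i then \<lambda>y. y\<^sup>2 else (\<lambda>_. 1)) (x $ j)) = (x $ i)\<^sup>2" for x :: "real^'m"
    using prod.delta[of UNIV i "\<lambda>j. (x $ j)\<^sup>2"] by (simp add: if_distribR cong: if_cong)
  ultimately show ?thesis using True by (simp add: prod.delta power2_eq_square)
next
  case False
  have "has_bochner_integral (iso_gauss u) (\<lambda>x :: real^'m. \<Prod>j\<in>UNIV. (if j = i \<or> j = k then \<lambda>y. y else (\<lambda>_. 1)) (x $ j))
     (\<Prod>j\<in>(UNIV :: 'm set). if j = i \<or> j = k then 0 else 1)"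
    by (rule has_bochner_integral_iso_gauss_prod) (use normal_moments(1,2) in auto)
  moreover have "(\<Prod>j\<in>UNIV. (if j = i \<or> j = k then \<lambda>y. y else (\<lambda>_. 1)) (x $ j)) = x $ i * x $ k" for x :: "real^'m"
  proof -
    have "(\<Prod>j\<in>UNIV. (if j = i \<or> j = k then \<lambda>y. y else (\<lambda>_. 1)) (x $ j))
      = (\<Prod>j\<in>UNIV. (if j = i then x $ j else 1) * (if j = k then x $ j else 1))"
      using False by (intro prod.cong) auto
    then show ?thesis by (simp add: prod.distrib prod.delta)
  qed
  moreover have "(\<Prod>j\<in>(UNIV :: 'm set). if j = i \<or> j = k then 0 else 1) = (0 :: real)"
    by (rule prod_zero) auto
  ultimately show ?thesis using False by simp
qed

lemma has_bochner_integral_iso_gauss_inner: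
  "has_bochner_integral (iso_gauss u) (\<lambda>x :: real^'m. inner c x) 0"
proof -
  have "has_bochner_integral (iso_gauss u) (\<lambda>x :: real^'m. \<Sum>i\<in>UNIV. c $ i * x $ i) (\<Sum>i\<in>(UNIV :: 'm set). c $ i * 0)"
    by (intro has_bochner_integral_sum has_bochner_integral_mult_right has_bochner_integral_iso_gauss_component)
  then show ?thesis by (simp add: inner_vec_def)
qed

lemma has_bochner_integral_iso_gauss_inner_square:
  "has_bochner_integral (iso_gauss u) (\<lambda>x :: real^'m. (inner c x)\<^sup>2) (u * (norm c)\<^sup>2)"
proof -
  have "has_bochner_integral (iso_gauss u)
      (\<lambda>x :: real^'m. \<Sum>i\<in>UNIV. \<Sum>k\<in>UNIV. (c $ i * c $ k) * (x $ i * x $ k))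
      (\<Sum>i\<in>UNIV. \<Sum>k\<in>(UNIV :: 'm set). (c $ i * c $ k) * (if i = k then u else 0))"
    by (intro has_bochner_integral_sum has_bochner_integral_mult_right has_bochner_integral_iso_gauss_component2)
  moreover have "(\<Sum>i\<in>UNIV. \<Sum>k\<in>UNIV. (c $ i * c $ k) * (x $ i * x $ k)) = (inner c x)\<^sup>2" for x :: "real^'m"
    by (simp add: inner_vec_def power2_eq_square sum_product mult_ac)
  moreover have "(\<Sum>i\<in>UNIV. \<Sum>k\<in>(UNIV :: 'm set). (c $ i * c $ k) * (if i = k then u else 0)) = u * (norm c)\<^sup>2"
    by (simp add: power2_norm_eq_inner inner_vec_def sum_distrib_left mult_ac if_distrib cong: if_cong)
  ultimately show ?thesis by simp
qed

text \<open>Each row contributes \<open>u\<close> times its squared norm, and the norm of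
  \<open>real^'m^'d\<close> is the Frobenius norm. Equality matters here: a lost factor would spoil
  the match with Khasminskii's condition.\<close>

lemma has_bochner_integral_iso_gauss_matrix_square:
  fixes B :: "real^'m^'d"
  shows "has_bochner_integral (iso_gauss u) (\<lambda>x. (norm (B *v x))\<^sup>2) (u * (norm B)\<^sup>2)"
proof -
  have "has_bochner_integral (iso_gauss u) (\<lambda>x. \<Sum>i\<in>UNIV. (inner (B $ i) x)\<^sup>2) (\<Sum>i\<in>UNIV. u * (norm (B $ i))\<^sup>2)"
    by (intro has_bochner_integral_sum has_bochner_integral_iso_gauss_inner_square)
  moreover have "(\<Sum>i\<in>UNIV. (inner (B $ i) x)\<^sup>2) = (norm (B *v x))\<^sup>2" for x
    unfolding power2_norm_eq_inner inner_vec_def[of "B *v x"] by (simp add: matrix_vector_mul_component power2_eq_square)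
  moreover have "(\<Sum>i\<in>UNIV. u * (norm (B $ i))\<^sup>2) = u * (norm B)\<^sup>2"
    unfolding power2_norm_eq_inner inner_vec_def[of B] by (simp add: sum_distrib_left)
  ultimately show ?thesis by simp
qed

text \<open>What counts is the scaling \<open>u ^ n\<close>: after division by it the moment is
  bounded by a constant that depends only on \<open>n\<close> and the dimension.\<close>

lemma iso_gauss_norm_moment:
  "integrable (iso_gauss u) (\<lambda>x :: real^'m. norm x ^ (2 * n))"
  "(\<integral>x. norm (x :: real^'m) ^ (2 * n) \<partial>iso_gauss u) \<le> real CARD('m) ^ (2 * n + 1) * (fact (2 * n) / (2 ^ n * fact n)) * u ^ n"
proof -
  let ?c = "fact (2 * n) / (2 ^ n * fact n) * u ^ n"
  have 1: "has_bochner_integral (iso_gauss u) (\<lambda>x :: real^'m. (x $ i) ^ (2 * n)) ?c" for i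
  proof -
    have "has_bochner_integral (iso_gauss u) (\<lambda>x :: real^'m. \<Prod>j\<in>UNIV. (if j = i then \<lambda>y. y ^ (2 * n) else (\<lambda>_. 1)) (x $ j))
       (\<Prod>j\<in>(UNIV :: 'm set). if j = i then ?c else 1)"
      by (rule has_bochner_integral_iso_gauss_prod) (use normal_moments(1) normal_moments(4)[of n] in auto)
    moreover have "(\<Prod>j\<in>UNIV. (if j = i then \<lambda>y. y ^ (2 * n) else (\<lambda>_. 1)) (x $ j)) = (x $ i) ^ (2 * n)" for x :: "real^'m"
      using prod.delta[of UNIV i "\<lambda>j. (x $ j) ^ (2 * n)"] by (simp add: if_distribR cong: if_cong)
    ultimately show ?thesis by (simp add: prod.delta)
  qed
  let ?b = "\<lambda>x :: real^'m. real CARD('m) ^ (2 * n) * (\<Sum>i\<in>UNIV. (x $ i) ^ (2 * n))"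
  have 2: "has_bochner_integral (iso_gauss u) ?b (real CARD('m) ^ (2 * n) * (\<Sum>i\<in>(UNIV :: 'm set). ?c))"
    by (intro has_bochner_integral_mult_right has_bochner_integral_sum 1)
  have 3: "norm x ^ (2 * n) \<le> ?b x" for x :: "real^'m"
    using norm_power_le_sum[of x "2 * n"] by (simp add: power_even_abs)
  show int: "integrable (iso_gauss u) (\<lambda>x :: real^'m. norm x ^ (2 * n))"
    by (rule Bochner_Integration.integrable_bound[of _ ?b])
       (use 2 3 in \<open>auto simp: has_bochner_integral_iff intro: order_trans[OF _ abs_ge_self]\<close>)
  have "(\<integral>x. norm (x :: real^'m) ^ (2 * n) \<partial>iso_gauss u) \<le> (\<integral>x. ?b x \<partial>iso_gauss u)"
    using int 2 3 by (intro integral_mono) (auto simp: has_bochner_integral_iff)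
  also have "\<dots> = real CARD('m) ^ (2 * n) * (\<Sum>i\<in>(UNIV :: 'm set). ?c)"
    using 2 by (simp only: has_bochner_integral_iff)
  finally show "(\<integral>x. norm (x :: real^'m) ^ (2 * n) \<partial>iso_gauss u) \<le> real CARD('m) ^ (2 * n + 1) * (fact (2 * n) / (2 ^ n * fact n)) * u ^ n"
    by (simp add: mult_ac)
qed

end

section \<open>The expected growth over one step of deterministic length\<close>

lemma norm_matrix_vector_mult_le:
  fixes B :: "real^'m^'d"
  shows "norm (B *v z) \<le> norm B * norm z"
proof (rule power2_le_imp_le)
  have "(norm (B *v z))\<^sup>2 = (\<Sum>i\<in>UNIV. (inner (B $ i) z)\<^sup>2)"
    unfolding power2_norm_eq_inner inner_vec_def[of "B *v z"]
    by (simp add: matrix_vector_mul_component power2_eq_square)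
  also have "\<dots> \<le> (\<Sum>i\<in>UNIV. (norm (B $ i))\<^sup>2 * (norm z)\<^sup>2)"
    by (intro sum_mono) (metis Cauchy_Schwarz_ineq power2_norm_eq_inner)
  also have "\<dots> = (norm B * norm z)\<^sup>2"
    unfolding power_mult_distrib power2_norm_eq_inner inner_vec_def[of B]
    by (simp add: sum_distrib_right)
  finally show "(norm (B *v z))\<^sup>2 \<le> (norm B * norm z)\<^sup>2" .
qed simp

text \<open>The parameter \<open>\<theta>\<close> is the cube root of the step length \<open>u\<close>, so that no fractional powers occur.\<close>
lemma iso_gauss_one_step:
  fixes p L A :: real
  assumes p: "p \<ge> 2" and L: "L \<ge> 1" and A: "A \<ge> 0"
  obtains lam :: real where "lam \<ge> 0"
    "\<And>\<theta> u y a (B :: real^'m^'d). 0 < \<theta> \<Longrightarrow> \<theta> \<le> 1 \<Longrightarrow> u = \<theta> ^ 3 \<Longrightarrow>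
       \<theta> * norm a \<le> L * sqrt (1 + (norm y)\<^sup>2) \<Longrightarrow>
       \<theta> * (norm B)\<^sup>2 \<le> L\<^sup>2 * (1 + (norm y)\<^sup>2) \<Longrightarrow>
       2 * inner y a + (p - 1) * (norm B)\<^sup>2 \<le> 2 * A * (1 + (norm y)\<^sup>2) \<Longrightarrow>
       (\<integral>\<^sup>+ z. ennreal ((1 + (norm (y + u *\<^sub>R a + B *v z))\<^sup>2) powr (p / 2)) \<partial>iso_gauss u)
         \<le> ennreal ((1 + lam * u) * (1 + (norm y)\<^sup>2) powr (p / 2))"
proof -
  obtain C :: real and n :: nat where C: "C \<ge> 0" and n: "n \<ge> 3"
    and T: "\<And>y z :: real^'d. (1 + (norm (y + z))\<^sup>2) powr (p / 2) \<le> (1 + (norm y)\<^sup>2) powr (p / 2) *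
       (1 + (p * inner y z + p * (p - 1) / 2 * (norm z)\<^sup>2) / (1 + (norm y)\<^sup>2)
         + C * ((norm z / sqrt (1 + (norm y)\<^sup>2)) ^ 3 + (norm z / sqrt (1 + (norm y)\<^sup>2)) ^ (2 * n)))"
    using one_plus_norm_square_powr_le_Taylor2[OF p] by blast
  define D where "D = C * (2 * L ^ (2 * n) * 2 ^ (2 * n))"
  define Cn where "Cn = real CARD('m) ^ (2 * n + 1) * (fact (2 * n) / (2 ^ n * fact n))"
  \<comment> \<open>The three summands are the contributions of Khasminskii's condition, of the
    squared drift and of the Taylor remainder; \<open>1 + Cn\<close> bounds the mean of
    \<open>1 + |z| ^ (2 * n) / u ^ n\<close>.\<close>
  define lam where "lam = p * A + p * (p - 1) / 2 * L\<^sup>2 + D * (1 + Cn)"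
  have D: "D \<ge> 0" using C L by (simp add: D_def)
  have Cn: "Cn \<ge> 0" by (simp add: Cn_def)
  have "lam \<ge> 0" using p A D Cn by (simp add: lam_def)
  moreover have "(\<integral>\<^sup>+ z. ennreal ((1 + (norm (y + u *\<^sub>R a + B *v z))\<^sup>2) powr (p / 2)) \<partial>iso_gauss u)
         \<le> ennreal ((1 + lam * u) * (1 + (norm y)\<^sup>2) powr (p / 2))"
    if th: "0 < \<theta>" "\<theta> \<le> 1" and u: "u = \<theta> ^ 3"
      and a: "\<theta> * norm a \<le> L * sqrt (1 + (norm y)\<^sup>2)"
      and B: "\<theta> * (norm B)\<^sup>2 \<le> L\<^sup>2 * (1 + (norm y)\<^sup>2)"
      and K: "2 * inner y a + (p - 1) * (norm B)\<^sup>2 \<le> 2 * A * (1 + (norm y)\<^sup>2)"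
    for \<theta> u y a and B :: "real^'m^'d"
  proof -
    define V where "V = (1 + (norm y)\<^sup>2) powr (p / 2)"
    define v where "v = sqrt (1 + (norm y)\<^sup>2)"
    have v: "v \<ge> 1" and v2: "1 + (norm y)\<^sup>2 = v\<^sup>2" by (simp_all add: v_def)
    have u0: "u > 0" using u th by simp
    have "1 + (norm y)\<^sup>2 \<noteq> 0" using add_pos_nonneg[OF zero_less_one zero_le_power2[of "norm y"]] by linarith
    then have V0: "V > 0" by (simp add: V_def)
    define w where "w = (\<lambda>z. norm (u *\<^sub>R a + B *v z) / v)"
    define \<zeta> where "\<zeta> = (\<lambda>z :: real^'m. norm z / sqrt u)"
    have z0: "\<zeta> z \<ge> 0" for z using u0 by (simp add: \<zeta>_def)
    have w0: "w z \<ge> 0" for z using v by (simp add: w_def)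
    have su: "sqrt u = \<theta> * sqrt \<theta>" using th by (simp add: u power3_eq_cube real_sqrt_mult)
    \<comment> \<open>\<open>\<zeta> z\<close> is the size of the increment in units of its standard
      deviation. In \<open>sqrt u = \<theta> * sqrt \<theta>\<close> the factor
      \<open>sqrt \<theta>\<close> is spent on \<open>|B|\<close>, and a full \<theta>
      remains.\<close>
    have wb: "w z \<le> L * \<theta> * (1 + \<zeta> z)" for z
    proof -
      have 1: "u * norm a \<le> \<theta> * (L * v)"
      proof -
        have "u * norm a = \<theta>\<^sup>2 * (\<theta> * norm a)" by (simp add: u power2_eq_square power3_eq_cube)
        also have "\<dots> \<le> \<theta> * (L * v)"
          using th power_decreasing[of 1 2 \<theta>] by (intro mult_mono[OF _ a[folded v_def]]) auto
        finally show ?thesis .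
      qed
      have "sqrt \<theta> * norm B = sqrt (\<theta> * (norm B)\<^sup>2)" by (simp add: real_sqrt_mult)
      also have "\<dots> \<le> sqrt (L\<^sup>2 * v\<^sup>2)" using B unfolding v2 by (rule real_sqrt_le_mono)
      also have "\<dots> = L * v" using L v by (simp add: real_sqrt_mult)
      finally have Bs: "sqrt \<theta> * norm B \<le> L * v" .
      have "norm B * norm z = (sqrt \<theta> * norm B) * (\<theta> * \<zeta> z)"
        using th by (simp add: \<zeta>_def su field_simps)
      also have "\<dots> \<le> (L * v) * (\<theta> * \<zeta> z)"
        using Bs th z0 by (intro mult_right_mono) auto
      finally have 2: "norm B * norm z \<le> L * v * (\<theta> * \<zeta> z)" .
      have "norm (u *\<^sub>R a + B *v z) \<le> u * norm a + norm B * norm z"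
        using norm_triangle_ineq[of "u *\<^sub>R a" "B *v z"] norm_matrix_vector_mult_le[of B z] u0 by simp
      also have "\<dots> \<le> (L * \<theta> * (1 + \<zeta> z)) * v" using 1 2 by (simp add: algebra_simps)
      finally show ?thesis using v by (simp add: w_def pos_divide_le_eq)
    qed
    \<comment> \<open>The reason for a third-order expansion: as \<theta> is at most 1, every power
      from the third on is at most \<open>\<theta> ^ 3 = u\<close>, so the remainder is of first
      order in the step length.\<close>
    have wj: "w z ^ j \<le> L ^ (2 * n) * u * (1 + \<zeta> z) ^ (2 * n)" if j: "3 \<le> j" "j \<le> 2 * n" for j z
    proof -
      have "w z ^ j \<le> (L * \<theta> * (1 + \<zeta> z)) ^ j" using wb w0 by (intro power_mono) auto
      also have "\<dots> = L ^ j * \<theta> ^ j * (1 + \<zeta> z) ^ j" by (simp add: power_mult_distrib)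
      also have "\<dots> \<le> L ^ (2 * n) * \<theta> ^ 3 * (1 + \<zeta> z) ^ (2 * n)"
        using L th z0[of z] j by (intro mult_mono power_increasing power_decreasing) auto
      finally show ?thesis by (simp add: u)
    qed
    have zn: "(1 + \<zeta> z) ^ (2 * n) \<le> 2 ^ (2 * n) * (1 + norm z ^ (2 * n) / u ^ n)" for z
    proof -
      have "1 + \<zeta> z \<le> 2 * max 1 (\<zeta> z)" by simp
      then have "(1 + \<zeta> z) ^ (2 * n) \<le> (2 * max 1 (\<zeta> z)) ^ (2 * n)" using z0[of z] by (intro power_mono) auto
      also have "\<dots> = 2 ^ (2 * n) * max 1 (\<zeta> z) ^ (2 * n)" by (simp add: power_mult_distrib)
      also have "max 1 (\<zeta> z) ^ (2 * n) \<le> 1 + \<zeta> z ^ (2 * n)" using z0[of z] by (auto simp: max_def)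
      also have "\<zeta> z ^ (2 * n) = norm z ^ (2 * n) / u ^ n"
        using u0 by (simp add: \<zeta>_def power_divide power_mult)
      finally show ?thesis by simp
    qed
    \<comment> \<open>\<open>c\<close> collects the terms free of \<open>z\<close>. The linear form
      given by \<open>b\<close> includes the cross term of drift and noise from the squared
      increment; it has mean 0, so its size is irrelevant.\<close>
    define c where "c = p / v\<^sup>2 * (u * inner y a) + p * (p - 1) / 2 / v\<^sup>2 * (u\<^sup>2 * (norm a)\<^sup>2)"
    define b where "b = (p / v\<^sup>2) *\<^sub>R (y v* B) + (p * (p - 1) / v\<^sup>2 * u) *\<^sub>R (a v* B)"
    define Q where "Q = (\<lambda>z. 1 + c + inner b z + p * (p - 1) / 2 / v\<^sup>2 * (norm (B *v z))\<^sup>2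
      + D * u * (1 + norm z ^ (2 * n) / u ^ n))"
    have le: "(1 + (norm (y + u *\<^sub>R a + B *v z))\<^sup>2) powr (p / 2) \<le> V * Q z" for z
    proof -
      have 1: "(1 + (norm (y + u *\<^sub>R a + B *v z))\<^sup>2) powr (p / 2) \<le> V *
       (1 + (p * inner y (u *\<^sub>R a + B *v z) + p * (p - 1) / 2 * (norm (u *\<^sub>R a + B *v z))\<^sup>2) / v\<^sup>2
         + C * (w z ^ 3 + w z ^ (2 * n)))"
        using T[of y "u *\<^sub>R a + B *v z"] by (simp add: V_def w_def v_def add.assoc)
      have 2: "C * (w z ^ 3 + w z ^ (2 * n)) \<le> D * u * (1 + norm z ^ (2 * n) / u ^ n)"
      proof -
        have "w z ^ 3 + w z ^ (2 * n) \<le> 2 * (L ^ (2 * n) * u * (1 + \<zeta> z) ^ (2 * n))"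
          using wj[of 3 z] wj[of "2 * n" z] n by simp
        also have "\<dots> \<le> 2 * (L ^ (2 * n) * u * (2 ^ (2 * n) * (1 + norm z ^ (2 * n) / u ^ n)))"
          using zn L u0 by (intro mult_left_mono) auto
        finally have "C * (w z ^ 3 + w z ^ (2 * n)) \<le> C * \<dots>" using C by (intro mult_left_mono) auto
        then show ?thesis by (simp add: D_def mult_ac)
      qed
      have 3: "(p * inner y (u *\<^sub>R a + B *v z) + p * (p - 1) / 2 * (norm (u *\<^sub>R a + B *v z))\<^sup>2) / v\<^sup>2
        = c + inner b z + p * (p - 1) / 2 / v\<^sup>2 * (norm (B *v z))\<^sup>2"
      proof -
        have "(norm (u *\<^sub>R a + B *v z))\<^sup>2 = u\<^sup>2 * (norm a)\<^sup>2 + 2 * u * inner a (B *v z) + (norm (B *v z))\<^sup>2"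
          unfolding power2_norm_eq_inner
          by (simp add: inner_add inner_commute[of "B *v z" a] power2_eq_square algebra_simps)
        then show ?thesis using v
          by (simp add: c_def b_def inner_add dot_lmul_matrix field_simps)
      qed
      show ?thesis
        by (rule order_trans[OF 1]) (use 2 3 V0 in \<open>auto simp: Q_def intro!: mult_left_mono\<close>)
    qed
    \<comment> \<open>\<open>Q\<close> contains a linear term, so its sign is not visible; it is
      nonnegative because \<open>V * Q z\<close> dominates a power. This permits the passage from
      the nonnegative integral to the exact moments.\<close>
    have Q0: "Q z \<ge> 0" for z
    proof -
      have "0 \<le> V * Q z" using le[of z] by (rule order_trans[rotated]) simp
      then show ?thesis using V0 by (simp add: zero_le_mult_iff)
    qed
    interpret prob_space "iso_gauss u :: (real^'m) measure" by (rule prob_space_iso_gauss[OF u0])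
    define I where "I = (\<integral>z. norm (z :: real^'m) ^ (2 * n) \<partial>iso_gauss u)"
    have I: "I \<le> Cn * u ^ n"
      using iso_gauss_norm_moment(2)[OF u0, of n, where 'm = 'm] by (simp add: I_def Cn_def)
    have hQ: "has_bochner_integral (iso_gauss u) Q
      (1 + c + 0 + p * (p - 1) / 2 / v\<^sup>2 * (u * (norm B)\<^sup>2) + D * u * (1 + I / u ^ n))"
    proof -
      have "has_bochner_integral (iso_gauss u :: (real^'m) measure) (\<lambda>z. r) r" for r :: real
        using prob_space by (simp add: has_bochner_integral_iff)
      moreover have "has_bochner_integral (iso_gauss u :: (real^'m) measure) (\<lambda>z. norm z ^ (2 * n)) I"
        using iso_gauss_norm_moment(1)[OF u0] by (simp add: has_bochner_integral_iff I_def)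
      ultimately show ?thesis unfolding Q_def
        by (intro has_bochner_integral_add has_bochner_integral_mult_right
            has_bochner_integral_iso_gauss_inner has_bochner_integral_iso_gauss_matrix_square
            has_bochner_integral_divide_zero u0)
    qed
    \<comment> \<open>With \<open>u = \<theta> ^ 3\<close>, the left side is
      \<open>u * \<theta> * (\<theta> * |a|)\<^sup>2\<close>, and the spare \<theta> is at most
      1.\<close>
    have ua: "u\<^sup>2 * (norm a)\<^sup>2 \<le> u * (L\<^sup>2 * v\<^sup>2)"
    proof -
      have "(\<theta> * norm a)\<^sup>2 \<le> (L * v)\<^sup>2" using a th unfolding v_def by (intro power_mono) auto
      then have "u * (\<theta> * (\<theta> * norm a)\<^sup>2) \<le> u * (1 * (L * v)\<^sup>2)"
        using u0 th by (intro mult_left_mono mult_mono) auto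
      then show ?thesis by (simp add: u power2_eq_square power3_eq_cube mult_ac)
    qed
    have "c + p * (p - 1) / 2 / v\<^sup>2 * (u * (norm B)\<^sup>2)
        = (p / 2 * u * (2 * inner y a + (p - 1) * (norm B)\<^sup>2) + p * (p - 1) / 2 * (u\<^sup>2 * (norm a)\<^sup>2)) / v\<^sup>2"
      using v by (simp add: c_def field_simps)
    also have "\<dots> \<le> (p / 2 * u * (2 * A * v\<^sup>2) + p * (p - 1) / 2 * (u * (L\<^sup>2 * v\<^sup>2))) / v\<^sup>2"
      using K ua u0 p unfolding v2 by (intro divide_right_mono add_mono mult_left_mono) auto
    also have "\<dots> = (p * A + p * (p - 1) / 2 * L\<^sup>2) * u" using v by (simp add: field_simps)
    finally have 1: "c + p * (p - 1) / 2 / v\<^sup>2 * (u * (norm B)\<^sup>2) \<le> (p * A + p * (p - 1) / 2 * L\<^sup>2) * u" .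
    have "I / u ^ n \<le> Cn" using I u0 by (simp add: pos_divide_le_eq)
    then have 2: "D * u * (1 + I / u ^ n) \<le> D * u * (1 + Cn)" using D u0 by (intro mult_left_mono) auto
    have EQ: "integral\<^sup>L (iso_gauss u) Q \<le> 1 + lam * u"
      using hQ 1 2 by (simp add: has_bochner_integral_iff lam_def algebra_simps)
    have "(\<integral>\<^sup>+ z. ennreal ((1 + (norm (y + u *\<^sub>R a + B *v z))\<^sup>2) powr (p / 2)) \<partial>iso_gauss u)
        \<le> (\<integral>\<^sup>+ z. ennreal (V * Q z) \<partial>iso_gauss u)"
      using le by (intro nn_integral_mono ennreal_leI)
    also have "\<dots> = ennreal (\<integral>z. V * Q z \<partial>iso_gauss u)"
      using hQ Q0 V0 by (intro nn_integral_eq_integral) (auto simp: has_bochner_integral_iff)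
    also have "\<dots> \<le> ennreal (V * (1 + lam * u))"
      using EQ V0 by (intro ennreal_leI) simp
    finally show ?thesis by (simp add: V_def mult_ac)
  qed
  ultimately show ?thesis using that by blast
qed

subsection \<open>Increments of Brownian motion over random time intervals\<close>

lemma tendsto_floor_grid: "(\<lambda>k. real_of_int \<lfloor>x * real (Suc k)\<rfloor> / real (Suc k)) \<longlonglongrightarrow> x"
proof (rule tendsto_sandwich)
  show "\<forall>\<^sub>F k in sequentially. x - 1 / real (Suc k) \<le> real_of_int \<lfloor>x * real (Suc k)\<rfloor> / real (Suc k)"
  proof (intro always_eventually allI)
    fix k :: nat
    have "x * real (Suc k) - 1 \<le> real_of_int \<lfloor>x * real (Suc k)\<rfloor>" by linarith
    then have "(x * real (Suc k) - 1) / real (Suc k) \<le> real_of_int \<lfloor>x * real (Suc k)\<rfloor> / real (Suc k)"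
      by (rule divide_right_mono) simp
    then show "x - 1 / real (Suc k) \<le> real_of_int \<lfloor>x * real (Suc k)\<rfloor> / real (Suc k)"
      by (simp add: diff_divide_distrib del: of_nat_Suc)
  qed
  show "\<forall>\<^sub>F k in sequentially. real_of_int \<lfloor>x * real (Suc k)\<rfloor> / real (Suc k) \<le> x"
  proof (intro always_eventually allI)
    fix k :: nat
    have "real_of_int \<lfloor>x * real (Suc k)\<rfloor> / real (Suc k) \<le> (x * real (Suc k)) / real (Suc k)"
      by (intro divide_right_mono) auto
    then show "real_of_int \<lfloor>x * real (Suc k)\<rfloor> / real (Suc k) \<le> x" by (simp del: of_nat_Suc)
  qed
  show "(\<lambda>k. x - 1 / real (Suc k)) \<longlonglongrightarrow> x"
    using tendsto_diff[OF tendsto_const LIMSEQ_inverse_real_of_nat, of x] by (simp add: inverse_eq_divide)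
qed simp

lemma tendsto_ceiling_grid: "(\<lambda>k. real_of_int \<lceil>x * real (Suc k)\<rceil> / real (Suc k)) \<longlonglongrightarrow> x"
  using tendsto_minus[OF tendsto_floor_grid[of "- x"]] by (simp add: ceiling_def del: of_nat_Suc)

lemma continuous_on_matrix_vector_mult:
  fixes B :: "'a :: topological_space \<Rightarrow> real^'m^'d"
  assumes "continuous_on S B" "continuous_on S z"
  shows "continuous_on S (\<lambda>x. B x *v z x)"
  unfolding matrix_vector_mult_def using assms
  by (intro continuous_on_vec_lambda continuous_on_sum continuous_on_mult continuous_on_component)

lemma borel_measurable_matrix_vector_mult [measurable (raw)]:
  fixes B :: "'a \<Rightarrow> real^'m^'d"
  assumes "B \<in> borel_measurable M" "z \<in> borel_measurable M"
  shows "(\<lambda>x. B x *v z x) \<in> borel_measurable M"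
  by (rule borel_measurable_continuous_Pair[OF assms]) (intro continuous_on_matrix_vector_mult continuous_intros)

text \<open>The pair \<open>(\<tau>, Y)\<close> hidden after time \<open>r\<close>; the dummy value \<open>(-1, 0)\<close> is recognisable because \<open>\<tau> \<ge> 0\<close>.
  That these are all measurable says that \<open>\<tau>\<close> is a stopping time and \<open>Y\<close> is known at time \<open>\<tau>\<close>.\<close>
definition until_time :: "('a \<Rightarrow> real) \<Rightarrow> ('a \<Rightarrow> real^'d) \<Rightarrow> real \<Rightarrow> 'a \<Rightarrow> real \<times> (real^'d)" where
  "until_time \<tau> Y r \<omega> = (if \<tau> \<omega> \<le> r then (\<tau> \<omega>, Y \<omega>) else (-1, 0))"

definition stopped_adapted :: "(real \<Rightarrow> 'a measure) \<Rightarrow> ('a \<Rightarrow> real) \<Rightarrow> ('a \<Rightarrow> real^'d) \<Rightarrow> bool" where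
  "stopped_adapted F \<tau> Y \<longleftrightarrow> (\<forall>r\<ge>0. until_time \<tau> Y r \<in> measurable (F r) (borel \<Otimes>\<^sub>M borel))"

definition em_step :: "(real \<Rightarrow> 'a \<Rightarrow> real^'m) \<Rightarrow> (real \<times> (real^'d) \<Rightarrow> real) \<Rightarrow> (real^'d \<Rightarrow> real^'d) \<Rightarrow> (real^'d \<Rightarrow> real^'m^'d)
    \<Rightarrow> 'a \<Rightarrow> real \<times> (real^'d) \<Rightarrow> real \<times> (real^'d)" where
  "em_step W S Fc Gc \<omega> x = (fst x + S x, snd x + S x *\<^sub>R Fc (snd x) + Gc (snd x) *v (W (fst x + S x) \<omega> - W (fst x) \<omega>))"

context
  fixes M :: "'a measure" and F :: "real \<Rightarrow> 'a measure" and W :: "real \<Rightarrow> 'a \<Rightarrow> real^'m"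
  assumes bm: "brownian_motion M F W"
begin

lemma bm_prob_space: "prob_space M"
  and bm_subalgebra: "\<And>t. t \<ge> 0 \<Longrightarrow> subalgebra M (F t)"
  and bm_mono: "\<And>s t. 0 \<le> s \<Longrightarrow> s \<le> t \<Longrightarrow> subalgebra (F t) (F s)"
  and bm_adapted: "\<And>t. t \<ge> 0 \<Longrightarrow> W t \<in> borel_measurable (F t)"
  and bm_cont: "\<And>\<omega>. \<omega> \<in> space M \<Longrightarrow> continuous_on {0..} (\<lambda>t. W t \<omega>)"
  using bm unfolding brownian_motion_def filtration_on_def subalgebra_def by auto

lemma bm_space: "t \<ge> 0 \<Longrightarrow> space (F t) = space M"
  using bm_subalgebra unfolding subalgebra_def by auto

lemma bm_measurable: "t \<ge> 0 \<Longrightarrow> W t \<in> borel_measurable M"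
  using bm_adapted bm_subalgebra measurable_from_subalg by blast

lemma bm_increment:
  assumes "0 \<le> s" "s < t"
  shows "distributed M lborel (\<lambda>\<omega>. W t \<omega> - W s \<omega>)
          (\<lambda>x. \<Prod>j\<in>UNIV. ennreal (normal_density 0 (sqrt (t - s)) (x $ j)))"
    and "prob_space.indep_set M (sets (F s)) {(\<lambda>\<omega>. W t \<omega> - W s \<omega>) -` A \<inter> space M | A. A \<in> sets borel}"
proof -
  from bm have "\<forall>s t. 0 \<le> s \<and> s < t \<longrightarrow>
        distributed M lborel (\<lambda>\<omega>. W t \<omega> - W s \<omega>)
          (\<lambda>x. \<Prod>j\<in>UNIV. ennreal (normal_density 0 (sqrt (t - s)) (x $ j))) \<and>
        prob_space.indep_set M (sets (F s))
          {(\<lambda>\<omega>. W t \<omega> - W s \<omega>) -` A \<inter> space M | A. A \<in> sets borel}"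
    unfolding brownian_motion_def by (elim conjE) assumption
  note * = this[rule_format, OF conjI, OF assms]
  show "distributed M lborel (\<lambda>\<omega>. W t \<omega> - W s \<omega>)
          (\<lambda>x. \<Prod>j\<in>UNIV. ennreal (normal_density 0 (sqrt (t - s)) (x $ j)))"
    by (rule conjunct1[OF *])
  show "prob_space.indep_set M (sets (F s)) {(\<lambda>\<omega>. W t \<omega> - W s \<omega>) -` A \<inter> space M | A. A \<in> sets borel}"
    by (rule conjunct2[OF *])
qed

lemma bm_distr:
  assumes "0 \<le> r" "0 < u"
  shows "distr M borel (\<lambda>\<omega>. W (r + u) \<omega> - W r \<omega>) = iso_gauss u"
proof -
  have "distributed M lborel (\<lambda>\<omega>. W (r + u) \<omega> - W r \<omega>)
     (\<lambda>x. \<Prod>j\<in>UNIV. ennreal (normal_density 0 (sqrt ((r + u) - r)) (x $ j)))"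
    using assms by (intro bm_increment) auto
  then have "distr M lborel (\<lambda>\<omega>. W (r + u) \<omega> - W r \<omega>) = iso_gauss u"
    by (simp add: distributed_def iso_gauss_def)
  moreover have "distr M lborel (\<lambda>\<omega>. W (r + u) \<omega> - W r \<omega>) = distr M borel (\<lambda>\<omega>. W (r + u) \<omega> - W r \<omega>)"
    by (rule distr_cong) auto
  ultimately show ?thesis by simp
qed

text \<open>Independence at the deterministic time \<open>r\<close> says that both measures agree on
  rectangles, and these determine a product of \<sigma>-finite measures.\<close>

lemma bm_joint_distr:
  assumes r: "0 \<le> r" "0 < u" and X: "X \<in> measurable (F r) N"
  shows "distr M N X \<Otimes>\<^sub>M iso_gauss u = distr M (N \<Otimes>\<^sub>M borel) (\<lambda>\<omega>. (X \<omega>, W (r + u) \<omega> - W r \<omega>))"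
proof -
  interpret prob_space M by (rule bm_prob_space)
  let ?D = "\<lambda>\<omega>. W (r + u) \<omega> - W r \<omega>"
  have D[measurable]: "?D \<in> borel_measurable M" using bm_measurable[of r] bm_measurable[of "r + u"] r by simp
  have X'[measurable]: "X \<in> measurable M N" using X bm_subalgebra[OF r(1)] measurable_from_subalg by blast
  interpret G: prob_space "iso_gauss u :: (real^'m) measure" by (rule prob_space_iso_gauss[OF r(2)])
  interpret X: prob_space "distr M N X" by (rule prob_space_distr) measurable
  have ind: "indep_set (sets (F r)) {?D -` A \<inter> space M |A. A \<in> sets borel}"
    using r by (intro bm_increment) auto
  show ?thesis
  proof (rule pair_measure_eqI)
    fix A B assume A: "A \<in> sets (distr M N X)" and B: "B \<in> sets (iso_gauss u :: (real^'m) measure)"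
    then have [measurable]: "A \<in> sets N" "B \<in> sets borel" by simp_all
    have "X -` A \<inter> space M \<in> sets (F r)"
      using measurable_sets[OF X \<open>A \<in> sets N\<close>] bm_space[OF r(1)] by simp
    moreover have "?D -` B \<inter> space M \<in> {?D -` A \<inter> space M |A. A \<in> sets borel}" using \<open>B \<in> sets borel\<close> by blast
    ultimately have "prob ((X -` A \<inter> space M) \<inter> (?D -` B \<inter> space M)) = prob (X -` A \<inter> space M) * prob (?D -` B \<inter> space M)"
      using ind unfolding indep_sets2_eq by blast
    moreover have "(\<lambda>\<omega>. (X \<omega>, ?D \<omega>)) -` (A \<times> B) \<inter> space M = (X -` A \<inter> space M) \<inter> (?D -` B \<inter> space M)" by auto
    ultimately show "emeasure (distr M N X) A * emeasure (iso_gauss u) B =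
        emeasure (distr M (N \<Otimes>\<^sub>M borel) (\<lambda>\<omega>. (X \<omega>, ?D \<omega>))) (A \<times> B)"
      unfolding bm_distr[OF r, symmetric]
      by (simp add: emeasure_distr emeasure_eq_measure ennreal_mult'')
  qed (use X.sigma_finite_measure_axioms G.sigma_finite_measure_axioms in \<open>auto cong: sets_pair_measure_cong\<close>)
qed

text \<open>A substitute for conditional expectation: under the product law the value of
  \<open>X\<close> is frozen while the increment is integrated out.\<close>

lemma bm_nn_integral_increment_le:
  assumes r: "0 \<le> r" "0 < u" and X: "X \<in> measurable (F r) N"
    and \<Psi>: "\<Psi> \<in> borel_measurable (N \<Otimes>\<^sub>M borel)" and \<Theta>: "\<Theta> \<in> borel_measurable N"
    and le: "\<And>x. x \<in> space N \<Longrightarrow> (\<integral>\<^sup>+ z. \<Psi> (x, z) \<partial>iso_gauss u) \<le> \<Theta> x"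
  shows "(\<integral>\<^sup>+ \<omega>. \<Psi> (X \<omega>, W (r + u) \<omega> - W r \<omega>) \<partial>M) \<le> (\<integral>\<^sup>+ \<omega>. \<Theta> (X \<omega>) \<partial>M)"
proof -
  interpret prob_space M by (rule bm_prob_space)
  let ?D = "\<lambda>\<omega>. W (r + u) \<omega> - W r \<omega>"
  have D[measurable]: "?D \<in> borel_measurable M" using bm_measurable[of r] bm_measurable[of "r + u"] r by simp
  have X'[measurable]: "X \<in> measurable M N" using X bm_subalgebra[OF r(1)] measurable_from_subalg by blast
  note [measurable] = \<Psi> \<Theta>
  interpret G: prob_space "iso_gauss u :: (real^'m) measure" by (rule prob_space_iso_gauss[OF r(2)])
  have "(\<integral>\<^sup>+ \<omega>. \<Psi> (X \<omega>, ?D \<omega>) \<partial>M) = integral\<^sup>N (distr M (N \<Otimes>\<^sub>M borel) (\<lambda>\<omega>. (X \<omega>, ?D \<omega>))) \<Psi>"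
    by (subst nn_integral_distr) auto
  also have "\<dots> = (\<integral>\<^sup>+ x. \<integral>\<^sup>+ z. \<Psi> (x, z) \<partial>iso_gauss u \<partial>distr M N X)"
    unfolding bm_joint_distr[OF r X, symmetric] by (subst G.nn_integral_fst) auto
  also have "\<dots> \<le> (\<integral>\<^sup>+ x. \<Theta> x \<partial>distr M N X)"
    using le by (intro nn_integral_mono) auto
  also have "\<dots> = (\<integral>\<^sup>+ \<omega>. \<Theta> (X \<omega>) \<partial>M)" by (subst nn_integral_distr) auto
  finally show ?thesis .
qed

text \<open>Rounded down to a grid, the time has countably many values, and at each of them
  \<open>W\<close> is taken at a deterministic time up to \<open>r\<close>. Refining the grid
  recovers the value at \<open>\<sigma>\<close> by path continuity.\<close>

lemma bm_measurable_random_time: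
  assumes r: "r \<ge> 0" and \<sigma>[measurable]: "\<sigma> \<in> borel_measurable (F r)"
    and rng: "\<And>\<omega>. \<omega> \<in> space M \<Longrightarrow> 0 \<le> \<sigma> \<omega> \<and> \<sigma> \<omega> \<le> r"
  shows "(\<lambda>\<omega>. W (\<sigma> \<omega>) \<omega>) \<in> borel_measurable (F r)"
proof (rule borel_measurable_LIMSEQ_metric)
  \<comment> \<open>The clamp keeps the grid time inside \<open>[0, r]\<close> for every integer
    index, including those that are never attained; at the attained times it has no effect in the
    limit.\<close>
  define c where "c = (\<lambda>x. max 0 (min r x))"
  show "(\<lambda>\<omega>. W (c (real_of_int \<lfloor>\<sigma> \<omega> * real (Suc k)\<rfloor> / real (Suc k))) \<omega>) \<in> borel_measurable (F r)" for k
  proof (rule measurable_compose_countable[where f = "\<lambda>i. W (c (real_of_int i / real (Suc k)))"])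
    show "W (c (real_of_int i / real (Suc k))) \<in> borel_measurable (F r)" for i
    proof -
      have "0 \<le> c (real_of_int i / real (Suc k))" "c (real_of_int i / real (Suc k)) \<le> r" using r by (auto simp: c_def)
      then show ?thesis using bm_adapted bm_mono measurable_from_subalg by blast
    qed
  qed measurable
  fix \<omega> assume "\<omega> \<in> space (F r)"
  then have \<omega>: "\<omega> \<in> space M" using bm_space r by simp
  have "(\<lambda>k. c (real_of_int \<lfloor>\<sigma> \<omega> * real (Suc k)\<rfloor> / real (Suc k))) \<longlonglongrightarrow> c (\<sigma> \<omega>)"
    unfolding c_def by (intro tendsto_intros tendsto_floor_grid)
  then have "(\<lambda>k. c (real_of_int \<lfloor>\<sigma> \<omega> * real (Suc k)\<rfloor> / real (Suc k))) \<longlonglongrightarrow> \<sigma> \<omega>"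
    using rng[OF \<omega>] by (simp add: c_def)
  then show "(\<lambda>k. W (c (real_of_int \<lfloor>\<sigma> \<omega> * real (Suc k)\<rfloor> / real (Suc k))) \<omega>) \<longlonglongrightarrow> W (\<sigma> \<omega>) \<omega>"
    by (rule continuous_on_tendsto_compose[OF bm_cont[OF \<omega>]]) (use rng[OF \<omega>] r in \<open>auto simp: c_def\<close>)
qed

text \<open>If the new time is at most \<open>r\<close>, so was the old one. Hence whatever is
  visible of the new pair at time \<open>r\<close> is a function of what was visible of the old pair
  and of the path up to \<open>r\<close>.\<close>

lemma stopped_adapted_em_step:
  fixes Fc :: "real^'d \<Rightarrow> real^'d"
  assumes ad: "stopped_adapted F \<tau> Y"
    and S[measurable]: "S \<in> borel_measurable (borel \<Otimes>\<^sub>M borel)"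
    and Fc[measurable]: "Fc \<in> borel_measurable borel" and Gc[measurable]: "Gc \<in> borel_measurable borel"
    and \<tau>0: "\<And>\<omega>. \<omega> \<in> space M \<Longrightarrow> 0 \<le> \<tau> \<omega>"
    and S0: "\<And>\<omega>. \<omega> \<in> space M \<Longrightarrow> 0 \<le> S (\<tau> \<omega>, Y \<omega>)"
  shows "stopped_adapted F (\<lambda>\<omega>. fst (em_step W S Fc Gc \<omega> (\<tau> \<omega>, Y \<omega>))) (\<lambda>\<omega>. snd (em_step W S Fc Gc \<omega> (\<tau> \<omega>, Y \<omega>)))"
  unfolding stopped_adapted_def
proof (intro allI impI)
  fix r :: real assume r: "r \<ge> 0"
  define X where "X = until_time \<tau> Y r"
  have X[measurable]: "X \<in> measurable (F r) (borel \<Otimes>\<^sub>M borel)"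
    using ad r unfolding stopped_adapted_def X_def by blast
  define c where "c = (\<lambda>x. max 0 (min r x))"
  have c[measurable]: "c \<in> borel_measurable borel" unfolding c_def by measurable
  have [measurable]: "(\<lambda>\<omega>. W (c (fst (X \<omega>))) \<omega>) \<in> borel_measurable (F r)"
    by (rule bm_measurable_random_time[OF r]) (use r in \<open>auto simp: c_def\<close>)
  have [measurable]: "(\<lambda>\<omega>. W (c (fst (X \<omega>) + S (X \<omega>))) \<omega>) \<in> borel_measurable (F r)"
    by (rule bm_measurable_random_time[OF r]) (use r in \<open>auto simp: c_def\<close>)
  \<comment> \<open>The test \<open>0 \<le> fst (X \<omega>)\<close> rejects the dummy time -1, and
    in the first branch both arguments of \<open>W\<close> lie in \<open>[0, r]\<close>, so the
    clamp \<open>c\<close> changes nothing.\<close>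
  have "(\<lambda>\<omega>. if 0 \<le> fst (X \<omega>) \<and> fst (X \<omega>) + S (X \<omega>) \<le> r
     then (fst (X \<omega>) + S (X \<omega>), snd (X \<omega>) + S (X \<omega>) *\<^sub>R Fc (snd (X \<omega>)) +
        Gc (snd (X \<omega>)) *v (W (c (fst (X \<omega>) + S (X \<omega>))) \<omega> - W (c (fst (X \<omega>))) \<omega>))
     else (-1, 0)) \<in> measurable (F r) (borel \<Otimes>\<^sub>M borel)" (is "?g \<in> _")
    by measurable
  moreover have "?g \<omega> = until_time (\<lambda>\<omega>. fst (em_step W S Fc Gc \<omega> (\<tau> \<omega>, Y \<omega>))) (\<lambda>\<omega>. snd (em_step W S Fc Gc \<omega> (\<tau> \<omega>, Y \<omega>))) r \<omega>"
    if "\<omega> \<in> space (F r)" for \<omega>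
  proof -
    have \<omega>: "\<omega> \<in> space M" using that bm_space r by simp
    show ?thesis using \<tau>0[OF \<omega>] S0[OF \<omega>] by (auto simp: X_def until_time_def em_step_def c_def)
  qed
  ultimately show "until_time (\<lambda>\<omega>. fst (em_step W S Fc Gc \<omega> (\<tau> \<omega>, Y \<omega>))) (\<lambda>\<omega>. snd (em_step W S Fc Gc \<omega> (\<tau> \<omega>, Y \<omega>))) r
      \<in> measurable (F r) (borel \<Otimes>\<^sub>M borel)"
    by (rule iffD1[OF measurable_cong, rotated])
qed


text \<open>The assumed independence only concerns deterministic times. So on a grid of mesh \<open>1/N\<close> the time \<open>\<tau>\<close> is
  rounded up, which keeps it a stopping time, and the step length is rounded down, which keeps it
  admissible for \<open>one_step\<close>; the limit \<open>N \<rightarrow> \<infinity>\<close> is taken by path continuity and Fatou's lemma.\<close>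
lemma em_step_expectation_le:
  fixes Fc :: "real^'d \<Rightarrow> real^'d"
  assumes ad: "stopped_adapted F \<tau> Y"
    and S[measurable]: "S \<in> borel_measurable (borel \<Otimes>\<^sub>M borel)"
    and Fc[measurable]: "Fc \<in> borel_measurable borel" and Gc[measurable]: "Gc \<in> borel_measurable borel"
    and \<tau>0: "\<And>\<omega>. \<omega> \<in> space M \<Longrightarrow> 0 \<le> \<tau> \<omega>"
    and S0: "\<And>\<omega>. \<omega> \<in> space M \<Longrightarrow> 0 \<le> S (\<tau> \<omega>, Y \<omega>)"
    and \<tau>S: "\<And>\<omega>. \<omega> \<in> space M \<Longrightarrow> \<tau> \<omega> + S (\<tau> \<omega>, Y \<omega>) \<le> T"
    and lam: "lam \<ge> 0"
    and V: "continuous_on UNIV V" and V0: "\<And>y. V y \<ge> 0"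
    and one_step: "\<And>t y u. 0 < u \<Longrightarrow> u \<le> S (t, y) \<Longrightarrow>
        (\<integral>\<^sup>+ z. ennreal (V (y + u *\<^sub>R Fc y + Gc y *v z)) \<partial>iso_gauss u) \<le> ennreal ((1 + lam * u) * V y)"
  shows "(\<integral>\<^sup>+ \<omega>. ennreal (exp (- lam * fst (em_step W S Fc Gc \<omega> (\<tau> \<omega>, Y \<omega>))) * V (snd (em_step W S Fc Gc \<omega> (\<tau> \<omega>, Y \<omega>)))) \<partial>M)
    \<le> (\<integral>\<^sup>+ \<omega>. ennreal (exp (- lam * \<tau> \<omega>) * V (Y \<omega>)) \<partial>M)"
proof -
  have Vm[measurable]: "V \<in> borel_measurable borel" using V by (rule borel_measurable_continuous_onI)
  define N where "N = (\<lambda>k. real (Suc k))"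
  have N: "N k \<ge> 1" "N k > 0" for k by (auto simp: N_def)
  \<comment> \<open>One index bound serves both the rounded time and the rounded step, since each is
    at most \<open>T\<close>.\<close>
  define J where "J = (\<lambda>k. \<lceil>T * N k\<rceil>)"
  define cell where "cell = (\<lambda>k i j x. \<lceil>fst x * N k\<rceil> = i \<and> \<lfloor>S x * N k\<rfloor> = (j :: int))"
  define X where "X = (\<lambda>k i. until_time \<tau> Y (real_of_int i / N k))"
  define r where "r = (\<lambda>k i. real_of_int i / N k)"
  \<comment> \<open>The discount uses the true time \<open>fst x\<close>, although the increment
    starts at the rounded one. Thus \<Theta> is exactly the functional before the step, and the
    rounding error appears only in the limit.\<close>
  define \<Psi> where "\<Psi> = (\<lambda>k i j (x, z). if cell k i j x then
      ennreal (exp (- lam * (fst x + r k j)) * V (snd x + r k j *\<^sub>R Fc (snd x) + Gc (snd x) *v z)) else 0)"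
  define \<Theta> where "\<Theta> = (\<lambda>k i j x. if cell k i j x then ennreal (exp (- lam * fst x) * V (snd x)) else 0)"
  define D where "D = (\<lambda>k i j \<omega>. W (r k i + r k j) \<omega> - W (r k i) \<omega>)"
  define f where "f = (\<lambda>k \<omega>. \<Sum>i\<in>{0..J k}. \<Sum>j\<in>{0..J k}. \<Psi> k i j (X k i \<omega>, D k i j \<omega>))"
  have cell_meas[measurable]: "Measurable.pred (borel \<Otimes>\<^sub>M borel) (cell k i j)" for k i j
    unfolding cell_def ceiling_eq_iff floor_eq_iff by measurable
  have \<Psi>m[measurable]: "\<Psi> k i j \<in> borel_measurable ((borel \<Otimes>\<^sub>M borel) \<Otimes>\<^sub>M borel)" for k i j
    unfolding \<Psi>_def by measurable
  have \<Theta>m[measurable]: "\<Theta> k i j \<in> borel_measurable (borel \<Otimes>\<^sub>M borel)" for k i j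
    unfolding \<Theta>_def by measurable
  have r0: "r k i \<ge> 0" if "i \<ge> 0" for k i using that N(2)[of k] by (simp add: r_def)
  have XF: "X k i \<in> measurable (F (r k i)) (borel \<Otimes>\<^sub>M borel)" if "i \<ge> 0" for k i
    using ad r0[OF that] unfolding stopped_adapted_def X_def r_def by blast
  have Xm: "X k i \<in> measurable M (borel \<Otimes>\<^sub>M borel)" if "i \<ge> 0" for k i
    by (rule measurable_from_subalg[OF bm_subalgebra XF]) (use r0 that in auto)
  have Dm: "D k i j \<in> borel_measurable M" if "i \<ge> 0" "j \<ge> 0" for k i j
    unfolding D_def using r0 that by (intro borel_measurable_diff bm_measurable) auto
  have term_m: "(\<lambda>\<omega>. \<Psi> k i j (X k i \<omega>, D k i j \<omega>)) \<in> borel_measurable M" if "i \<ge> 0" "j \<ge> 0" for k i j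
    using measurable_Pair[OF Xm[OF that(1), of k] Dm[OF that, of k]] by measurable
  have fm: "f k \<in> borel_measurable M" for k
    unfolding f_def using term_m by (intro borel_measurable_sum) auto
  \<comment> \<open>On a cell the time is at most \<open>i / N k\<close>, so nothing is hidden by
    \<open>until_time\<close>. The dummy time -1 rounds to a negative index and so belongs to no
    cell considered.\<close>
  have cellX: "cell k i j (X k i \<omega>) \<longleftrightarrow> cell k i j (\<tau> \<omega>, Y \<omega>)" "cell k i j (\<tau> \<omega>, Y \<omega>) \<Longrightarrow> X k i \<omega> = (\<tau> \<omega>, Y \<omega>)"
    if i: "i \<ge> 0" for k i j \<omega>
  proof -
    have *: "\<tau> \<omega> \<le> real_of_int i / N k" if "cell k i j (\<tau> \<omega>, Y \<omega>)"
      using that N(2)[of k] by (simp add: cell_def pos_le_divide_eq ceiling_eq_iff)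
    have "\<not> cell k i j (-1, 0)" using i N(1)[of k] by (auto simp: cell_def ceiling_eq_iff)
    then show "cell k i j (X k i \<omega>) \<longleftrightarrow> cell k i j (\<tau> \<omega>, Y \<omega>)"
      using * by (auto simp: X_def until_time_def)
    show "cell k i j (\<tau> \<omega>, Y \<omega>) \<Longrightarrow> X k i \<omega> = (\<tau> \<omega>, Y \<omega>)" using * by (simp add: X_def until_time_def)
  qed
  have \<Theta>X: "\<Theta> k i j (X k i \<omega>) = \<Theta> k i j (\<tau> \<omega>, Y \<omega>)" if "i \<ge> 0" for k i j \<omega>
    using cellX[OF that, of k j \<omega>] by (simp add: \<Theta>_def)
  have term_le: "(\<integral>\<^sup>+ \<omega>. \<Psi> k i j (X k i \<omega>, D k i j \<omega>) \<partial>M) \<le> (\<integral>\<^sup>+ \<omega>. \<Theta> k i j (X k i \<omega>) \<partial>M)"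
    if i: "i \<ge> 0" and j: "j \<ge> 0" for k i j
  \<comment> \<open>A step rounded down to length 0 has no Gaussian density, but then the increment
    vanishes and the two integrands coincide.\<close>
  proof (cases "j = 0")
    case True
    then show ?thesis by (intro nn_integral_mono) (auto simp: \<Psi>_def \<Theta>_def D_def r_def)
  next
    case False
    then have u: "r k j > 0" using j N[of k] by (simp add: r_def)
    show ?thesis unfolding D_def
    proof (rule bm_nn_integral_increment_le[OF r0[OF i] u XF[OF i] \<Psi>m \<Theta>m])
      fix x :: "real \<times> (real^'d)"
      let ?u = "r k j"
      show "(\<integral>\<^sup>+ z. \<Psi> k i j (x, z) \<partial>iso_gauss ?u) \<le> \<Theta> k i j x"
      proof (cases "cell k i j x")
        case c: True
        have "real_of_int j \<le> S x * N k" using c by (simp add: cell_def floor_eq_iff)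
        then have uS: "?u \<le> S (fst x, snd x)" using N(2)[of k] by (simp add: r_def pos_divide_le_eq)
        have "(\<integral>\<^sup>+ z. \<Psi> k i j (x, z) \<partial>iso_gauss ?u) =
          (\<integral>\<^sup>+ z. ennreal (exp (- lam * (fst x + ?u))) * ennreal (V (snd x + ?u *\<^sub>R Fc (snd x) + Gc (snd x) *v z)) \<partial>iso_gauss ?u)"
          using c by (simp add: \<Psi>_def ennreal_mult V0)
        also have "\<dots> = ennreal (exp (- lam * (fst x + ?u))) *
            (\<integral>\<^sup>+ z. ennreal (V (snd x + ?u *\<^sub>R Fc (snd x) + Gc (snd x) *v z)) \<partial>iso_gauss ?u)"
          by (rule nn_integral_cmult) measurable
        also have "\<dots> \<le> ennreal (exp (- lam * (fst x + ?u))) * ennreal ((1 + lam * ?u) * V (snd x))"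
          by (intro mult_left_mono one_step[OF u uS]) auto
        also have "\<dots> = ennreal (exp (- lam * (fst x + ?u)) * ((1 + lam * ?u) * V (snd x)))"
          using lam u V0 by (simp add: ennreal_mult)
        also have "\<dots> \<le> ennreal (exp (- lam * fst x) * V (snd x))"
        proof (rule ennreal_leI)
          have "exp (- lam * ?u) * (1 + lam * ?u) \<le> exp (- lam * ?u) * exp (lam * ?u)"
            by (intro mult_left_mono) auto
          also have "\<dots> = 1" by (simp flip: exp_add)
          finally have "(exp (- lam * fst x) * V (snd x)) * (exp (- lam * ?u) * (1 + lam * ?u)) \<le> (exp (- lam * fst x) * V (snd x)) * 1"
            using V0 by (intro mult_left_mono) auto
          moreover have "exp (- lam * (fst x + ?u)) = exp (- lam * fst x) * exp (- lam * ?u)"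
            by (simp add: algebra_simps flip: exp_add)
          ultimately show "exp (- lam * (fst x + ?u)) * ((1 + lam * ?u) * V (snd x)) \<le> exp (- lam * fst x) * V (snd x)"
            by (simp add: mult_ac)
        qed
        finally show ?thesis using c by (simp add: \<Theta>_def)
      qed (simp add: \<Psi>_def \<Theta>_def)
    qed
  qed
  \<comment> \<open>For each point at most one pair of indices in the range satisfies
    \<open>cell\<close>, so the double sum has at most one nonzero term.\<close>
  have sum_cell: "(\<Sum>i\<in>{0..J k}. \<Sum>j\<in>{0..J k}. if cell k i j x then g i j else 0) =
     (if \<lceil>fst x * N k\<rceil> \<in> {0..J k} \<and> \<lfloor>S x * N k\<rfloor> \<in> {0..J k} then g \<lceil>fst x * N k\<rceil> \<lfloor>S x * N k\<rfloor> else 0)"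
    for k x and g :: "int \<Rightarrow> int \<Rightarrow> ennreal"
  proof -
    have "(\<Sum>j\<in>{0..J k}. if cell k i j x then g i j else 0) =
      (if \<lceil>fst x * N k\<rceil> = i then (if \<lfloor>S x * N k\<rfloor> \<in> {0..J k} then g i \<lfloor>S x * N k\<rfloor> else 0) else 0)" for i
      by (simp add: cell_def)
    then show ?thesis by simp
  qed
  have int_f: "(\<integral>\<^sup>+ \<omega>. f k \<omega> \<partial>M) \<le> (\<integral>\<^sup>+ \<omega>. ennreal (exp (- lam * \<tau> \<omega>) * V (Y \<omega>)) \<partial>M)" for k
  proof -
    have "(\<integral>\<^sup>+ \<omega>. f k \<omega> \<partial>M) = (\<Sum>i\<in>{0..J k}. \<Sum>j\<in>{0..J k}. \<integral>\<^sup>+ \<omega>. \<Psi> k i j (X k i \<omega>, D k i j \<omega>) \<partial>M)"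
      unfolding f_def using term_m
      by (subst nn_integral_sum, force intro!: borel_measurable_sum)
         (intro sum.cong nn_integral_sum; force)
    also have "\<dots> \<le> (\<Sum>i\<in>{0..J k}. \<Sum>j\<in>{0..J k}. \<integral>\<^sup>+ \<omega>. \<Theta> k i j (X k i \<omega>) \<partial>M)"
      by (intro sum_mono term_le) auto
    also have "\<dots> = (\<integral>\<^sup>+ \<omega>. (\<Sum>i\<in>{0..J k}. \<Sum>j\<in>{0..J k}. \<Theta> k i j (X k i \<omega>)) \<partial>M)"
    proof -
      have "(\<lambda>\<omega>. \<Theta> k i j (X k i \<omega>)) \<in> borel_measurable M" if "i \<ge> 0" for i j
        using Xm[OF that] \<Theta>m by (rule measurable_compose)
      then show ?thesis
        by (subst nn_integral_sum, force intro!: borel_measurable_sum)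
           (intro sum.cong nn_integral_sum[symmetric]; force)
    qed
    also have "\<dots> \<le> (\<integral>\<^sup>+ \<omega>. ennreal (exp (- lam * \<tau> \<omega>) * V (Y \<omega>)) \<partial>M)"
    proof (rule nn_integral_mono)
      fix \<omega>
      have "(\<Sum>i\<in>{0..J k}. \<Sum>j\<in>{0..J k}. \<Theta> k i j (X k i \<omega>)) = (\<Sum>i\<in>{0..J k}. \<Sum>j\<in>{0..J k}. \<Theta> k i j (\<tau> \<omega>, Y \<omega>))"
        using \<Theta>X by (intro sum.cong) auto
      also have "\<dots> \<le> ennreal (exp (- lam * \<tau> \<omega>) * V (Y \<omega>))" unfolding \<Theta>_def sum_cell by simp
      finally show "(\<Sum>i\<in>{0..J k}. \<Sum>j\<in>{0..J k}. \<Theta> k i j (X k i \<omega>)) \<le> ennreal (exp (- lam * \<tau> \<omega>) * V (Y \<omega>))" .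
    qed
    finally show ?thesis .
  qed
  have lim_f: "(\<lambda>k. f k \<omega>) \<longlonglongrightarrow> ennreal (exp (- lam * fst (em_step W S Fc Gc \<omega> (\<tau> \<omega>, Y \<omega>))) * V (snd (em_step W S Fc Gc \<omega> (\<tau> \<omega>, Y \<omega>))))"
    if \<omega>: "\<omega> \<in> space M" for \<omega>
  proof -
    define t y s where "t = \<tau> \<omega>" and "y = Y \<omega>" and "s = S (\<tau> \<omega>, Y \<omega>)"
    define tk where "tk = (\<lambda>k. real_of_int \<lceil>t * N k\<rceil> / N k)"
    define sk where "sk = (\<lambda>k. real_of_int \<lfloor>s * N k\<rfloor> / N k)"
    have ts: "0 \<le> t" "0 \<le> s" "t \<le> T" "s \<le> T"
      using \<tau>0[OF \<omega>] S0[OF \<omega>] \<tau>S[OF \<omega>] by (auto simp: t_def s_def)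
    have tk: "tk \<longlonglongrightarrow> t" and sk: "sk \<longlonglongrightarrow> s"
      unfolding tk_def sk_def N_def by (rule tendsto_ceiling_grid tendsto_floor_grid)+
    have i0: "0 \<le> \<lceil>t * N k\<rceil>" "0 \<le> \<lfloor>s * N k\<rfloor>" for k
    proof -
      have "0 \<le> t * N k" "0 \<le> s * N k" using ts N(2)[of k] by auto
      then show "0 \<le> \<lceil>t * N k\<rceil>" "0 \<le> \<lfloor>s * N k\<rfloor>" by linarith+
    qed
    have f_eq: "f k \<omega> = ennreal (exp (- lam * (t + sk k)) *
       V (y + sk k *\<^sub>R Fc y + Gc y *v (W (tk k + sk k) \<omega> - W (tk k) \<omega>)))" for k
    proof -
      have "t * N k \<le> T * N k" "s * N k \<le> T * N k" using ts N(2)[of k] by auto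
      then have "\<lceil>t * N k\<rceil> \<le> J k" "\<lfloor>s * N k\<rfloor> \<le> J k"
        unfolding J_def by (auto intro: ceiling_mono order_trans[OF floor_mono floor_le_ceiling])
      then have mem: "\<lceil>t * N k\<rceil> \<in> {0..J k}" "\<lfloor>s * N k\<rfloor> \<in> {0..J k}" using i0[of k] by auto
      have "f k \<omega> = (\<Sum>i\<in>{0..J k}. \<Sum>j\<in>{0..J k}. if cell k i j (t, y) then
         ennreal (exp (- lam * (t + r k j)) * V (y + r k j *\<^sub>R Fc y + Gc y *v D k i j \<omega>)) else 0)"
        unfolding f_def
      proof (intro sum.cong refl)
        fix i j assume "i \<in> {0..J k}" "j \<in> {0..J k}"
        then have i: "i \<ge> 0" by simp
        show "\<Psi> k i j (X k i \<omega>, D k i j \<omega>) = (if cell k i j (t, y) then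
         ennreal (exp (- lam * (t + r k j)) * V (y + r k j *\<^sub>R Fc y + Gc y *v D k i j \<omega>)) else 0)"
          using cellX[OF i, of k j \<omega>] by (simp add: \<Psi>_def t_def y_def)
      qed
      also have "\<dots> = ennreal (exp (- lam * (t + sk k)) *
         V (y + sk k *\<^sub>R Fc y + Gc y *v (W (tk k + sk k) \<omega> - W (tk k) \<omega>)))"
        unfolding sum_cell using mem by (simp add: tk_def sk_def r_def D_def s_def t_def y_def)
      finally show ?thesis .
    qed
    have pos: "0 \<le> tk k" "0 \<le> sk k" for k
      unfolding tk_def sk_def using i0[of k] N(2)[of k] by (intro divide_nonneg_pos; simp)+
    have W1: "(\<lambda>k. W (tk k) \<omega>) \<longlonglongrightarrow> W t \<omega>"
      by (rule continuous_on_tendsto_compose[OF bm_cont[OF \<omega>] tk]) (use ts pos in auto)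
    have W2: "(\<lambda>k. W (tk k + sk k) \<omega>) \<longlonglongrightarrow> W (t + s) \<omega>"
      by (rule continuous_on_tendsto_compose[OF bm_cont[OF \<omega>] tendsto_add[OF tk sk]]) (use ts pos in auto)
    have GW: "(\<lambda>k. Gc y *v (W (tk k + sk k) \<omega> - W (tk k) \<omega>)) \<longlonglongrightarrow> Gc y *v (W (t + s) \<omega> - W t \<omega>)"
    proof (rule continuous_on_tendsto_compose[where s = UNIV and f = "\<lambda>z. Gc y *v z"])
      show "continuous_on UNIV (\<lambda>z. Gc y *v z)" by (intro continuous_on_matrix_vector_mult continuous_intros)
    qed (auto intro!: tendsto_diff W1 W2)
    have "(\<lambda>k. V (y + sk k *\<^sub>R Fc y + Gc y *v (W (tk k + sk k) \<omega> - W (tk k) \<omega>)))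
        \<longlonglongrightarrow> V (y + s *\<^sub>R Fc y + Gc y *v (W (t + s) \<omega> - W t \<omega>))"
      by (rule continuous_on_tendsto_compose[OF V]) (auto intro!: tendsto_intros sk GW)
    then have "(\<lambda>k. f k \<omega>) \<longlonglongrightarrow> ennreal (exp (- lam * (t + s)) * V (y + s *\<^sub>R Fc y + Gc y *v (W (t + s) \<omega> - W t \<omega>)))"
      unfolding f_eq by (intro tendsto_ennrealI tendsto_intros sk)
    then show ?thesis by (simp add: em_step_def t_def s_def y_def)
  qed
  \<comment> \<open>Only an upper bound is wanted, so the pointwise limit may be read as a lower
    limit and no dominating function is required.\<close>
  have "(\<integral>\<^sup>+ \<omega>. ennreal (exp (- lam * fst (em_step W S Fc Gc \<omega> (\<tau> \<omega>, Y \<omega>))) * V (snd (em_step W S Fc Gc \<omega> (\<tau> \<omega>, Y \<omega>)))) \<partial>M)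
      = (\<integral>\<^sup>+ \<omega>. liminf (\<lambda>k. f k \<omega>) \<partial>M)"
    using lim_imp_Liminf[OF _ lim_f] by (intro nn_integral_cong) simp
  also have "\<dots> \<le> liminf (\<lambda>k. \<integral>\<^sup>+ \<omega>. f k \<omega> \<partial>M)"
    by (rule nn_integral_liminf[OF fm])
  also have "\<dots> \<le> liminf (\<lambda>k :: nat. \<integral>\<^sup>+ \<omega>. ennreal (exp (- lam * \<tau> \<omega>) * V (Y \<omega>)) \<partial>M)"
    by (intro Liminf_mono always_eventually allI int_f)
  finally show ?thesis by (simp add: Liminf_const)
qed

end

subsection \<open>Schemes with variable step length\<close>

text \<open>The discounted expectation does not grow from one iterate to the next, and all times
  stay in \<open>[0, T]\<close>, so removing the discount costs \<open>exp (lam * T)\<close> once.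
  The bound is therefore independent of \<open>n\<close>.\<close>

lemma em_iterate_expectation_le:
  fixes Fc :: "real^'d \<Rightarrow> real^'d"
  assumes bm: "brownian_motion M F W"
    and S: "S \<in> borel_measurable (borel \<Otimes>\<^sub>M borel)"
    and Fc: "Fc \<in> borel_measurable borel" and Gc: "Gc \<in> borel_measurable borel"
    and T: "T \<ge> 0"
    and S_bounds: "\<And>t y. 0 \<le> t \<Longrightarrow> t \<le> T \<Longrightarrow> 0 \<le> S (t, y) \<and> t + S (t, y) \<le> T"
    and lam: "lam \<ge> 0"
    and V: "continuous_on UNIV V" and V0: "\<And>y. V y \<ge> 0"
    and one_step: "\<And>t y u. 0 < u \<Longrightarrow> u \<le> S (t, y) \<Longrightarrow>
        (\<integral>\<^sup>+ z. ennreal (V (y + u *\<^sub>R Fc y + Gc y *v z)) \<partial>iso_gauss u) \<le> ennreal ((1 + lam * u) * V y)"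
  shows "(\<integral>\<^sup>+ \<omega>. ennreal (V (snd ((em_step W S Fc Gc \<omega> ^^ n) (0, x0)))) \<partial>M) \<le> ennreal (exp (lam * T) * V x0)"
proof -
  define Z where "Z = (\<lambda>n \<omega>. (em_step W S Fc Gc \<omega> ^^ n) (0, x0))"
  interpret prob_space M by (rule bm_prob_space[OF bm])
  have Z_Suc: "Z (Suc n) \<omega> = em_step W S Fc Gc \<omega> (fst (Z n \<omega>), snd (Z n \<omega>))" for n \<omega>
    by (simp add: Z_def)
  have rng: "0 \<le> fst (Z n \<omega>) \<and> fst (Z n \<omega>) \<le> T" for n \<omega>
  proof (induction n)
    case 0 then show ?case using T by (simp add: Z_def)
  next
    case (Suc n)
    then show ?case using S_bounds[of "fst (Z n \<omega>)" "snd (Z n \<omega>)"]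
      unfolding Z_Suc by (simp add: em_step_def)
  qed
  have ad: "stopped_adapted F (\<lambda>\<omega>. fst (Z n \<omega>)) (\<lambda>\<omega>. snd (Z n \<omega>))" for n
  proof (induction n)
    case 0
    have "until_time (\<lambda>\<omega>. fst (Z 0 \<omega>)) (\<lambda>\<omega>. snd (Z 0 \<omega>)) r = (\<lambda>_. (0, x0))" if "r \<ge> 0" for r
      using that by (simp add: until_time_def Z_def fun_eq_iff)
    then show ?case by (simp add: stopped_adapted_def)
  next
    case (Suc n)
    show ?case unfolding Z_Suc
    proof (rule stopped_adapted_em_step[OF bm Suc S Fc Gc])
      fix \<omega>
      show "0 \<le> fst (Z n \<omega>)" "0 \<le> S (fst (Z n \<omega>), snd (Z n \<omega>))"
        using rng[of n \<omega>] S_bounds[of "fst (Z n \<omega>)" "snd (Z n \<omega>)"] by blast+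
    qed
  qed
  have "(\<integral>\<^sup>+ \<omega>. ennreal (exp (- lam * fst (Z n \<omega>)) * V (snd (Z n \<omega>))) \<partial>M) \<le> ennreal (V x0)" for n
  proof (induction n)
    case 0 then show ?case by (simp add: Z_def emeasure_space_1)
  next
    case (Suc n)
    have "(\<integral>\<^sup>+ \<omega>. ennreal (exp (- lam * fst (Z (Suc n) \<omega>)) * V (snd (Z (Suc n) \<omega>))) \<partial>M)
        \<le> (\<integral>\<^sup>+ \<omega>. ennreal (exp (- lam * fst (Z n \<omega>)) * V (snd (Z n \<omega>))) \<partial>M)"
      unfolding Z_Suc
    proof (rule em_step_expectation_le[OF bm ad S Fc Gc])
      fix \<omega>
      show "0 \<le> fst (Z n \<omega>)" "0 \<le> S (fst (Z n \<omega>), snd (Z n \<omega>))"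
        "fst (Z n \<omega>) + S (fst (Z n \<omega>), snd (Z n \<omega>)) \<le> T"
        using rng[of n \<omega>] S_bounds[of "fst (Z n \<omega>)" "snd (Z n \<omega>)"] by blast+
    qed (fact lam V V0 one_step)+
    then show ?case using Suc by (rule order_trans)
  qed
  note E = this
  have "(\<integral>\<^sup>+ \<omega>. ennreal (V (snd (Z n \<omega>))) \<partial>M)
      \<le> (\<integral>\<^sup>+ \<omega>. ennreal (exp (lam * T)) * ennreal (exp (- lam * fst (Z n \<omega>)) * V (snd (Z n \<omega>))) \<partial>M)"
  proof (rule nn_integral_mono)
    fix \<omega>
    have "1 \<le> exp (lam * T) * exp (- lam * fst (Z n \<omega>))"
      using rng[of n \<omega>] lam by (simp add: mult_left_mono flip: exp_add)
    then have "1 * V (snd (Z n \<omega>)) \<le> exp (lam * T) * exp (- lam * fst (Z n \<omega>)) * V (snd (Z n \<omega>))"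
      using V0 by (intro mult_right_mono) auto
    then show "ennreal (V (snd (Z n \<omega>))) \<le> ennreal (exp (lam * T)) * ennreal (exp (- lam * fst (Z n \<omega>)) * V (snd (Z n \<omega>)))"
      by (simp add: V0 mult.assoc flip: ennreal_mult)
  qed
  also have "\<dots> = ennreal (exp (lam * T)) * (\<integral>\<^sup>+ \<omega>. ennreal (exp (- lam * fst (Z n \<omega>)) * V (snd (Z n \<omega>))) \<partial>M)"
  proof (rule nn_integral_cmult)
    \<comment> \<open>No time exceeds \<open>T\<close>, so hiding what happens after
      \<open>T\<close> hides nothing and adaptedness at \<open>T\<close> is measurability of the
      whole pair.\<close>
    have "until_time (\<lambda>\<omega>. fst (Z n \<omega>)) (\<lambda>\<omega>. snd (Z n \<omega>)) T \<in> measurable M (borel \<Otimes>\<^sub>M borel)"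
      using ad[of n] T measurable_from_subalg[OF bm_subalgebra[OF bm T]]
      unfolding stopped_adapted_def by blast
    also have "until_time (\<lambda>\<omega>. fst (Z n \<omega>)) (\<lambda>\<omega>. snd (Z n \<omega>)) T = Z n"
      using rng by (auto simp: until_time_def)
    finally have [measurable]: "Z n \<in> measurable M (borel \<Otimes>\<^sub>M borel)" .
    have [measurable]: "V \<in> borel_measurable borel" using V by (rule borel_measurable_continuous_onI)
    show "(\<lambda>\<omega>. ennreal (exp (- lam * fst (Z n \<omega>)) * V (snd (Z n \<omega>)))) \<in> borel_measurable M"
      by measurable
  qed
  also have "\<dots> \<le> ennreal (exp (lam * T)) * ennreal (V x0)" by (intro mult_left_mono E) auto
  also have "\<dots> = ennreal (exp (lam * T) * V x0)" by (simp add: V0 ennreal_mult)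
  finally show ?thesis unfolding Z_def .
qed

section \<open>The continuous-time approximations as iterates of a stopped scheme\<close>

lemma ats_seq_index:
  fixes Fc :: "real^'d \<Rightarrow> real^'d" and Gc :: "real^'d \<Rightarrow> real^'m^'d" and W :: "real \<Rightarrow> 'a \<Rightarrow> real^'m"
    and x0 :: "real^'d" and \<omega> :: 'a
  assumes \<Delta>: "\<And>y. d \<le> \<Delta> y" and d: "d > 0" and t: "t \<ge> 0"
  defines "i \<equiv> ats_index \<Delta> Fc Gc x0 W t \<omega>"
  shows "n \<le> i \<Longrightarrow> fst (ats_seq \<Delta> Fc Gc x0 W \<omega> n) \<le> t"
    and "t < fst (ats_seq \<Delta> Fc Gc x0 W \<omega> (Suc i))"
    and "i \<le> nat \<lceil>t / d\<rceil>"
proof -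
  define a where "a = (\<lambda>n. fst (ats_seq \<Delta> Fc Gc x0 W \<omega> n))"
  have a_Suc: "a n + d \<le> a (Suc n)" for n using \<Delta> by (simp add: a_def Let_def)
  have "a n \<le> a (Suc n)" for n using a_Suc[of n] d by linarith
  then have mono: "mono a" by (simp add: mono_iff_le_Suc)
  have nd: "real n * d \<le> a n" for n
  proof (induction n)
    case 0 then show ?case by (simp add: a_def)
  next
    case (Suc n) then show ?case using a_Suc[of n] by (simp add: algebra_simps)
  qed
  have bnd: "n \<le> nat \<lceil>t / d\<rceil>" if "a n \<le> t" for n
  proof -
    have "real n \<le> t / d" using nd[of n] that d by (simp add: pos_le_divide_eq)
    then show ?thesis by linarith
  qed
  \<comment> \<open>A positive lower bound on the steps makes the set under \<open>Max\<close>
    finite. It also bounds the index by a number that is the same for all paths, so a fixed number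
    of iterations can replace the random index.\<close>
  have fin: "finite {n. a n \<le> t}" by (rule finite_subset[OF _ finite_atMost[of "nat \<lceil>t / d\<rceil>"]]) (use bnd in blast)
  have ne: "0 \<in> {n. a n \<le> t}" using t by (simp add: a_def)
  have i_eq: "i = Max {n. a n \<le> t}" by (simp add: i_def ats_index_def a_def)
  have "Max {n. a n \<le> t} \<in> {n. a n \<le> t}" by (rule Max_in[OF fin]) (use ne in blast)
  then have "i \<in> {n. a n \<le> t}" unfolding i_eq[symmetric] .
  then have ai: "a i \<le> t" by simp
  show "n \<le> i \<Longrightarrow> fst (ats_seq \<Delta> Fc Gc x0 W \<omega> n) \<le> t" using ai monoD[OF mono, of n i] unfolding a_def by linarith
  show "t < fst (ats_seq \<Delta> Fc Gc x0 W \<omega> (Suc i))"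
  proof (rule ccontr)
    assume "\<not> ?thesis"
    then have "a (Suc i) \<le> t" unfolding a_def by (simp only: not_less)
    then have "Suc i \<le> Max {n. a n \<le> t}" by (intro Max_ge[OF fin]) simp
    then show False unfolding i_eq[symmetric] by simp
  qed
  show "i \<le> nat \<lceil>t / d\<rceil>" using bnd ai by blast
qed

lemma ats_seq_Suc_em_step:
  assumes "S (ats_seq \<Delta> Fc Gc x0 W \<omega> n) = \<Delta> (snd (ats_seq \<Delta> Fc Gc x0 W \<omega> n))"
  shows "em_step W S Fc Gc \<omega> (ats_seq \<Delta> Fc Gc x0 W \<omega> n) = ats_seq \<Delta> Fc Gc x0 W \<omega> (Suc n)"
  using assms by (simp add: em_step_def Let_def)

text \<open>Once the next step would pass \<open>t\<close>, the pair is a fixed point of the stopped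
  scheme, so all surplus iterations are harmless.\<close>

lemma ats_Ybar_eq_em_iterate:
  assumes \<Delta>: "\<And>y. d \<le> \<Delta> y" and d: "d > 0" and t: "t \<ge> 0"
  defines "S \<equiv> \<lambda>x. if fst x + \<Delta> (snd x) \<le> t then \<Delta> (snd x) else 0"
  shows "ats_Ybar \<Delta> Fc Gc x0 W t \<omega> = snd ((em_step W S Fc Gc \<omega> ^^ nat \<lceil>t / d\<rceil>) (0, x0))"
proof -
  let ?a = "ats_seq \<Delta> Fc Gc x0 W \<omega>"
  define i where "i = ats_index \<Delta> Fc Gc x0 W t \<omega>"
  note I = ats_seq_index[of d \<Delta>, OF \<Delta> d t, where Fc = Fc and Gc = Gc and ?x0.0 = x0 and W = W and \<omega> = \<omega>, folded i_def]
  have "(em_step W S Fc Gc \<omega> ^^ n) (0, x0) = ?a (min n i)" for n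
  proof (induction n)
    case (Suc n)
    show ?case
    proof (cases "n < i")
      case True
      then have "fst (?a (Suc n)) \<le> t" using I(1)[of "Suc n"] by simp
      then have "S (?a n) = \<Delta> (snd (?a n))" by (simp add: S_def Let_def)
      then show ?thesis using True Suc ats_seq_Suc_em_step[of S \<Delta> Fc Gc x0 W \<omega> n] by simp
    next
      case False
      have "S (?a i) = 0" using I(2) by (simp add: S_def Let_def)
      then have "em_step W S Fc Gc \<omega> (?a i) = ?a i" by (simp add: em_step_def)
      then show ?thesis using False Suc by simp
    qed
  qed simp
  then show ?thesis using I(3) by (simp add: ats_Ybar_def i_def)
qed

text \<open>The iterates follow the scheme to the last grid point up to \<open>t\<close>; one more
  step, possibly of length 0, lands exactly at \<open>t\<close>. That step is the \<open>Suc\<close>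
  in the number of iterations, and afterwards the remaining time is 0.\<close>

lemma ats_Y_eq_em_iterate:
  assumes \<Delta>: "\<And>y. d \<le> \<Delta> y" and d: "d > 0" and t: "t \<ge> 0"
  defines "S \<equiv> \<lambda>x. min (\<Delta> (snd x)) (t - fst x)"
  shows "ats_Y \<Delta> Fc Gc x0 W t \<omega> = snd ((em_step W S Fc Gc \<omega> ^^ Suc (nat \<lceil>t / d\<rceil>)) (0, x0))"
proof -
  let ?a = "ats_seq \<Delta> Fc Gc x0 W \<omega>"
  define i where "i = ats_index \<Delta> Fc Gc x0 W t \<omega>"
  note I = ats_seq_index[of d \<Delta>, OF \<Delta> d t, where Fc = Fc and Gc = Gc and ?x0.0 = x0 and W = W and \<omega> = \<omega>, folded i_def]
  have before: "(em_step W S Fc Gc \<omega> ^^ n) (0, x0) = ?a n" if "n \<le> i" for n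
    using that
  proof (induction n)
    case (Suc n)
    then have "fst (?a (Suc n)) \<le> t" using I(1)[of "Suc n"] by simp
    then have "S (?a n) = \<Delta> (snd (?a n))" by (simp add: S_def Let_def)
    then show ?case using Suc ats_seq_Suc_em_step[of S \<Delta> Fc Gc x0 W \<omega> n] by simp
  qed simp
  have after: "(em_step W S Fc Gc \<omega> ^^ Suc (i + k)) (0, x0) = (t, ats_Y \<Delta> Fc Gc x0 W t \<omega>)" for k
  proof (induction k)
    case 0
    have "S (?a i) = t - fst (?a i)" using I(2) by (simp add: S_def Let_def)
    then have "em_step W S Fc Gc \<omega> (?a i) = (t, ats_Y \<Delta> Fc Gc x0 W t \<omega>)"
      by (simp add: em_step_def ats_Y_def Let_def flip: i_def)
    then show ?case using before[of i] by simp
  next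
    case (Suc k)
    have "S (t, y) = 0" for y using \<Delta>[of y] d by (simp add: S_def)
    then have "em_step W S Fc Gc \<omega> (t, y) = (t, y)" for y by (simp add: em_step_def)
    then show ?case using Suc by simp
  qed
  have "i + (nat \<lceil>t / d\<rceil> - i) = nat \<lceil>t / d\<rceil>" using I(3) by simp
  then show ?thesis using after[of "nat \<lceil>t / d\<rceil> - i"] by simp
qed

lemma ats_moment_bound:
  fixes Fc :: "real^'d \<Rightarrow> real^'d" and Gc :: "real^'d \<Rightarrow> real^'m^'d"
  assumes bm: "brownian_motion M F W"
    and \<Delta>[measurable]: "\<Delta> \<in> borel_measurable borel"
    and Fc: "Fc \<in> borel_measurable borel" and Gc: "Gc \<in> borel_measurable borel"
    and d: "d > 0" "\<And>y. d \<le> \<Delta> y" and t: "t \<ge> 0" and lam: "lam \<ge> 0"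
    and V: "continuous_on UNIV V" and V0: "\<And>y. V y \<ge> 0"
    and one_step: "\<And>y u. 0 < u \<Longrightarrow> u \<le> \<Delta> y \<Longrightarrow>
        (\<integral>\<^sup>+ z. ennreal (V (y + u *\<^sub>R Fc y + Gc y *v z)) \<partial>iso_gauss u) \<le> ennreal ((1 + lam * u) * V y)"
  shows "(\<integral>\<^sup>+ \<omega>. ennreal (V (ats_Ybar \<Delta> Fc Gc x0 W t \<omega>)) \<partial>M) \<le> ennreal (exp (lam * t) * V x0)"
    and "(\<integral>\<^sup>+ \<omega>. ennreal (V (ats_Y \<Delta> Fc Gc x0 W t \<omega>)) \<partial>M) \<le> ennreal (exp (lam * t) * V x0)"
proof -
  have \<Delta>0: "\<Delta> y > 0" for y using d(1) d(2)[of y] by simp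
  show "(\<integral>\<^sup>+ \<omega>. ennreal (V (ats_Ybar \<Delta> Fc Gc x0 W t \<omega>)) \<partial>M) \<le> ennreal (exp (lam * t) * V x0)"
    unfolding ats_Ybar_eq_em_iterate[of d \<Delta>, OF d(2) d(1) t]
  proof (rule em_iterate_expectation_le[OF bm _ Fc Gc t _ lam V V0])
    show "(\<lambda>x. if fst x + \<Delta> (snd x) \<le> t then \<Delta> (snd x) else 0) \<in> borel_measurable (borel \<Otimes>\<^sub>M borel)"
      by measurable
    fix t' y u
    show "0 \<le> t' \<Longrightarrow> t' \<le> t \<Longrightarrow> 0 \<le> (if fst (t', y) + \<Delta> (snd (t', y)) \<le> t then \<Delta> (snd (t', y)) else 0) \<and>
        t' + (if fst (t', y) + \<Delta> (snd (t', y)) \<le> t then \<Delta> (snd (t', y)) else 0) \<le> t"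
      using \<Delta>0[of y] by simp
    assume "0 < u" "u \<le> (if fst (t', y) + \<Delta> (snd (t', y)) \<le> t then \<Delta> (snd (t', y)) else 0)"
    then show "(\<integral>\<^sup>+ z. ennreal (V (y + u *\<^sub>R Fc y + Gc y *v z)) \<partial>iso_gauss u) \<le> ennreal ((1 + lam * u) * V y)"
      by (intro one_step) (auto split: if_splits)
  qed
  show "(\<integral>\<^sup>+ \<omega>. ennreal (V (ats_Y \<Delta> Fc Gc x0 W t \<omega>)) \<partial>M) \<le> ennreal (exp (lam * t) * V x0)"
    unfolding ats_Y_eq_em_iterate[of d \<Delta>, OF d(2) d(1) t]
  proof (rule em_iterate_expectation_le[OF bm _ Fc Gc t _ lam V V0])
    show "(\<lambda>x. min (\<Delta> (snd x)) (t - fst x)) \<in> borel_measurable (borel \<Otimes>\<^sub>M borel)"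
      by measurable
    fix t' y u
    show "0 \<le> t' \<Longrightarrow> t' \<le> t \<Longrightarrow> 0 \<le> min (\<Delta> (snd (t', y))) (t - fst (t', y)) \<and>
        t' + min (\<Delta> (snd (t', y))) (t - fst (t', y)) \<le> t"
      using \<Delta>0[of y] by simp
    assume "0 < u" "u \<le> min (\<Delta> (snd (t', y))) (t - fst (t', y))"
    then show "(\<integral>\<^sup>+ z. ennreal (V (y + u *\<^sub>R Fc y + Gc y *v z)) \<partial>iso_gauss u) \<le> ennreal ((1 + lam * u) * V y)"
      by (intro one_step) auto
  qed
qed

subsection \<open>The truncated coefficients\<close>

lemma local_lipschitz_imp_continuous:
  fixes f :: "'a :: real_normed_vector \<Rightarrow> 'b :: real_normed_vector"
  assumes "\<And>R. R > 0 \<Longrightarrow> \<exists>C>0. \<forall>x y. norm x \<le> R \<and> norm y \<le> R \<longrightarrow> norm (f x - f y) \<le> C * norm (x - y)"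
  shows "continuous_on UNIV f"
proof (rule continuous_at_imp_continuous_on, rule)
  fix x :: 'a
  define R where "R = norm x + 1"
  have R: "R > 0" by (simp add: R_def add_nonneg_pos)
  then obtain C where C: "C > 0" "\<And>x y. norm x \<le> R \<and> norm y \<le> R \<Longrightarrow> norm (f x - f y) \<le> C * norm (x - y)"
    using assms by blast
  have "C-lipschitz_on (ball 0 R) f"
    using C by (intro lipschitz_onI) (auto simp: dist_norm)
  then have "continuous_on (ball 0 R) f" by (rule lipschitz_on_continuous_on)
  then show "isCont f x" by (simp add: continuous_on_eq_continuous_at R_def)
qed

context
  fixes \<phi> :: "real \<Rightarrow> real" and \<rho> K \<gamma> dc dh :: real
  assumes phi_mono: "strict_mono_on {0..} \<phi>" and phi_cont: "continuous_on {0..} \<phi>"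
    and phi_ge1: "\<forall>r\<ge>0. \<phi> r \<ge> 1" and phi_lim: "filterlim \<phi> at_top at_top"
    and gamma_pos: "0 < \<gamma>" and gamma_le: "\<gamma> \<le> 1/3" and K_ge: "K \<ge> \<phi> 1"
    and rho_ge: "\<rho> \<ge> 1" and dc: "0 < dc" "dc \<le> 1" and dh: "dh = dc / \<rho>"
begin

definition trunc_radius :: real where
  "trunc_radius = the_inv_into {0..} \<phi> (K * dh powr (- \<gamma>))"

lemma dh_bounds: "0 < dh" "dh \<le> 1"
  using dc rho_ge by (auto simp: dh divide_le_eq)

text \<open>As \<open>dh \<le> 1\<close> and \<open>K \<ge> \<phi> 1\<close>, the argument of the
  inverse is at least \<open>\<phi> 1\<close>; it is attained by the intermediate value theorem, and
  uniquely by strict monotonicity. A radius of at least 1 is what the transfer of Khasminskii's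
  condition needs.\<close>

lemma trunc_radius: "trunc_radius \<ge> 1" "\<phi> trunc_radius = K * dh powr (- \<gamma>)"
proof -
  have K1: "K \<ge> 1" using K_ge phi_ge1 by (metis order_trans zero_le_one)
  have "1 powr (- \<gamma>) \<le> dh powr (- \<gamma>)" using dh_bounds gamma_pos by (intro powr_mono2') auto
  then have "1 \<le> dh powr (- \<gamma>)" by simp
  then have "K * 1 \<le> K * dh powr (- \<gamma>)" using K1 by (intro mult_left_mono) auto
  then have k: "\<phi> 1 \<le> K * dh powr (- \<gamma>)" using K_ge by simp
  obtain b where b: "b \<ge> 1" "\<phi> b \<ge> K * dh powr (- \<gamma>)"
  proof -
    have "\<forall>\<^sub>F x in at_top. K * dh powr (- \<gamma>) \<le> \<phi> x" using phi_lim unfolding filterlim_at_top by blast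
    then have "\<forall>\<^sub>F x in at_top. K * dh powr (- \<gamma>) \<le> \<phi> x \<and> x \<ge> 1"
      using eventually_ge_at_top[of "1 :: real"] by eventually_elim simp
    then show ?thesis using that by (metis (lifting) eventually_happens' trivial_limit_at_top_linorder)
  qed
  have "continuous_on {1..b} \<phi>" by (rule continuous_on_subset[OF phi_cont]) auto
  then obtain R where R: "1 \<le> R" "\<phi> R = K * dh powr (- \<gamma>)"
    using IVT'[of \<phi> 1 "K * dh powr (- \<gamma>)" b] k b by auto
  have "trunc_radius = R"
    unfolding trunc_radius_def R(2)[symmetric]
    using R(1) by (intro the_inv_into_f_f strict_mono_on_imp_inj_on[OF phi_mono]) auto
  then show "trunc_radius \<ge> 1" "\<phi> trunc_radius = K * dh powr (- \<gamma>)" using R by auto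
qed

lemma ats_proj_eq: "ats_proj \<phi> K \<gamma> dh x = (if norm x \<le> trunc_radius then x else (trunc_radius / norm x) *\<^sub>R x)"
  using trunc_radius(1) by (auto simp: ats_proj_def min_def simp flip: trunc_radius_def)

lemma ats_delta_bounds: "dh \<le> ats_delta \<phi> dh dc y" "ats_delta \<phi> dh dc y \<le> 1"
proof -
  have "dc \<le> 1 * \<phi> (norm y)" using phi_ge1 dc by (metis mult_1 norm_ge_zero order_trans)
  moreover have "\<phi> (norm y) > 0" using phi_ge1 by (metis less_le_trans norm_ge_zero zero_less_one)
  ultimately have "dc / \<phi> (norm y) \<le> 1" by (simp add: divide_le_eq)
  then show "dh \<le> ats_delta \<phi> dh dc y" "ats_delta \<phi> dh dc y \<le> 1"
    using dh_bounds by (auto simp: ats_delta_def)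
qed

lemma phi_norm_measurable [measurable]: "(\<lambda>y. \<phi> (norm (y :: real^'d))) \<in> borel_measurable borel"
  by (intro borel_measurable_continuous_onI continuous_on_compose2[OF phi_cont] continuous_intros) auto

lemma ats_delta_measurable [measurable]: "(ats_delta \<phi> dh dc :: real^'d \<Rightarrow> real) \<in> borel_measurable borel"
  unfolding ats_delta_def by measurable

lemma ats_coef_measurable:
  fixes h :: "real^'d \<Rightarrow> 'b :: topological_space"
  assumes [measurable]: "h \<in> borel_measurable borel"
  shows "ats_coef \<phi> K \<gamma> dh dc h \<in> borel_measurable borel"
proof -
  have [measurable]: "(ats_proj \<phi> K \<gamma> dh :: real^'d \<Rightarrow> real^'d) \<in> borel_measurable borel"
    unfolding ats_proj_eq[abs_def] by measurable
  show ?thesis unfolding ats_coef_def by measurable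
qed

context
  fixes f :: "real^'d \<Rightarrow> real^'d" and g :: "real^'d \<Rightarrow> real^'m^'d"
  assumes phi_bound: "\<forall>r>0. \<forall>x. norm x \<le> r \<longrightarrow>
                       norm (f x) / (1 + norm x) \<le> \<phi> r \<and> (norm (g x))\<^sup>2 / (1 + norm x)\<^sup>2 \<le> \<phi> r"
begin

lemma growth:
  assumes "r > 0" "norm x \<le> r"
  shows "norm (f x) \<le> \<phi> r * (1 + norm x)" "(norm (g x))\<^sup>2 \<le> \<phi> r * (1 + norm x)\<^sup>2"
proof -
  have *: "1 + norm x > 0" by (simp add: add_pos_nonneg)
  have b: "norm (f x) / (1 + norm x) \<le> \<phi> r" "(norm (g x))\<^sup>2 / (1 + norm x)\<^sup>2 \<le> \<phi> r"
    using phi_bound[rule_format, OF assms] by auto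
  show "norm (f x) \<le> \<phi> r * (1 + norm x)" using b(1) pos_divide_le_eq[OF *] by blast
  show "(norm (g x))\<^sup>2 \<le> \<phi> r * (1 + norm x)\<^sup>2" using b(2) pos_divide_le_eq[OF zero_less_power[OF *]] by blast
qed

lemma ats_coef_growth:
  assumes u: "0 < u" "u \<le> ats_delta \<phi> dh dc y"
  shows "root 3 u * norm (ats_coef \<phi> K \<gamma> dh dc f y) \<le> (K + \<rho>) * (1 + norm y)"
    and "root 3 u * (norm (ats_coef \<phi> K \<gamma> dh dc g y))\<^sup>2 \<le> (K + \<rho>) * (1 + norm y)\<^sup>2"
proof -
  have K1: "K \<ge> 1" using K_ge phi_ge1 by (metis order_trans zero_le_one)
  have th: "0 < root 3 u" "root 3 u \<le> 1" using u ats_delta_bounds(2)[of y] by auto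
  \<comment> \<open>Both coefficients are evaluated at one point \<open>x\<close>, which is
    \<open>y\<close> or its projection, and \<open>k\<close> is the value of \<phi> at a radius that
    bounds \<open>x\<close>. Both estimates follow from this common form.\<close>
  have "\<exists>x k. ats_coef \<phi> K \<gamma> dh dc f y = f x \<and> ats_coef \<phi> K \<gamma> dh dc g y = g x \<and> norm x \<le> norm y \<and>
     norm (f x) \<le> k * (1 + norm x) \<and> (norm (g x))\<^sup>2 \<le> k * (1 + norm x)\<^sup>2 \<and> k \<ge> 0 \<and> root 3 u * k \<le> K + \<rho>"
  proof (cases "ats_delta \<phi> dh dc y > dh")
    case True
    have p0: "\<phi> (norm y) > 0" using phi_ge1 by (metis less_le_trans norm_ge_zero zero_less_one)
    have "dc / \<phi> (norm y) > dc / \<rho>" using True by (simp add: ats_delta_def dh)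
    then have "\<phi> (norm y) < \<rho>" using dc p0 rho_ge by (simp add: field_simps)
    \<comment> \<open>The growth bound needs a positive radius, which fails at \<open>y = 0\<close>.
      The maximum with 1 repairs this, at the price of \<open>\<phi> 1 \<le> K\<close> beside
      \<rho>; hence the constant \<open>K + \<rho>\<close>.\<close>
    moreover define r where "r = max 1 (norm y)"
    ultimately have "\<phi> r \<le> K + \<rho>" using K_ge K1 rho_ge by (auto simp: max_def)
    moreover have "\<phi> r \<ge> 0" using phi_ge1 by (metis max.cobounded1 order_trans r_def zero_le_one)
    moreover have "root 3 u * \<phi> r \<le> 1 * \<phi> r" using th \<open>\<phi> r \<ge> 0\<close> by (intro mult_right_mono) auto
    ultimately show ?thesis using True growth[of r y]
      by (intro exI[of _ y] exI[of _ "\<phi> r"]) (auto simp: ats_coef_def r_def)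
  next
    case False
    then have udh: "u \<le> dh" using u by (simp add: ats_delta_def)
    define x where "x = ats_proj \<phi> K \<gamma> dh y"
    have x: "norm x \<le> norm y" "norm x \<le> trunc_radius" using trunc_radius(1) by (auto simp: x_def ats_proj_eq)
    \<comment> \<open>The step is at most the minimal one, so the product is at most
      \<open>dh powr (1/3 - \<gamma>)\<close>, whose exponent is nonnegative.\<close>
    have "root 3 u * dh powr (- \<gamma>) \<le> 1"
    proof -
      have "root 3 u = u powr (1/3)" using u by (simp add: root_powr_inverse)
      also have "\<dots> \<le> dh powr (1/3)" using u udh by (intro powr_mono2) auto
      also have "\<dots> \<le> dh powr \<gamma>" using dh_bounds gamma_le by (intro powr_mono') auto
      finally have "root 3 u * dh powr (- \<gamma>) \<le> dh powr \<gamma> * dh powr (- \<gamma>)" by (intro mult_right_mono) auto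
      then show ?thesis using dh_bounds by (simp flip: powr_add)
    qed
    then have "K * (root 3 u * dh powr (- \<gamma>)) \<le> K * 1" using K1 by (intro mult_left_mono) auto
    then have "root 3 u * \<phi> trunc_radius \<le> K + \<rho>"
      using rho_ge by (simp add: trunc_radius(2) mult_ac)
    moreover have "\<phi> trunc_radius \<ge> 0" using trunc_radius(2) K1 by simp
    ultimately show ?thesis using False x trunc_radius(1) growth[of trunc_radius x]
      by (intro exI[of _ x] exI[of _ "\<phi> trunc_radius"]) (auto simp: ats_coef_def x_def)
  qed
  then obtain x k where x: "ats_coef \<phi> K \<gamma> dh dc f y = f x" "ats_coef \<phi> K \<gamma> dh dc g y = g x" "norm x \<le> norm y"
    and fg: "norm (f x) \<le> k * (1 + norm x)" "(norm (g x))\<^sup>2 \<le> k * (1 + norm x)\<^sup>2"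
    and k: "k \<ge> 0" "root 3 u * k \<le> K + \<rho>" by blast
  have "root 3 u * norm (f x) \<le> root 3 u * (k * (1 + norm y))"
    using fg(1) x(3) k(1) th by (intro mult_left_mono order_trans[OF fg(1)]) auto
  also have "\<dots> \<le> (K + \<rho>) * (1 + norm y)"
    using k(2) by (simp only: mult.assoc[symmetric]) (intro mult_right_mono, auto)
  finally show "root 3 u * norm (ats_coef \<phi> K \<gamma> dh dc f y) \<le> (K + \<rho>) * (1 + norm y)" using x by simp
  have "root 3 u * (norm (g x))\<^sup>2 \<le> root 3 u * (k * (1 + norm y)\<^sup>2)"
    using fg(2) x(3) k(1) th by (intro mult_left_mono order_trans[OF fg(2)] power_mono) auto
  also have "\<dots> \<le> (K + \<rho>) * (1 + norm y)\<^sup>2"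
    using k(2) by (simp only: mult.assoc[symmetric]) (intro mult_right_mono, auto)
  finally show "root 3 u * (norm (ats_coef \<phi> K \<gamma> dh dc g y))\<^sup>2 \<le> (K + \<rho>) * (1 + norm y)\<^sup>2" using x by simp
qed

text \<open>Outside the ball of radius \<open>R\<close> write \<open>y = c *\<^sub>R x\<close> with
  \<open>x\<close> on the sphere and \<open>c \<ge> 1\<close>. Then the inner product is multiplied
  by \<open>c\<close>, and so may be the nonnegative term with \<open>g\<close>, which leaves
  \<open>c\<close> times the condition at \<open>x\<close>. Finally
  \<open>c * (1 + R\<^sup>2) = |y| / R + |y| * R\<close> is at most twice
  \<open>1 + |y|\<^sup>2\<close> because \<open>1 \<le> R < |y|\<close>; this is the origin of the
  doubled \<alpha>.\<close>

lemma ats_coef_khasminskii: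
  assumes p: "p \<ge> 2" and \<alpha>: "\<alpha> \<ge> 0"
    and kh: "\<And>x. inner x (f x) + (p - 1) / 2 * (norm (g x))\<^sup>2 \<le> \<alpha> * (1 + (norm x)\<^sup>2)"
  shows "2 * inner y (ats_coef \<phi> K \<gamma> dh dc f y) + (p - 1) * (norm (ats_coef \<phi> K \<gamma> dh dc g y))\<^sup>2
    \<le> 2 * (2 * \<alpha>) * (1 + (norm y)\<^sup>2)"
proof -
  have kh2: "2 * inner x (f x) + (p - 1) * (norm (g x))\<^sup>2 \<le> 2 * \<alpha> * (1 + (norm x)\<^sup>2)" for x
    using kh[of x] by simp
  have v: "0 \<le> 2 * \<alpha> * (1 + (norm y)\<^sup>2)" using \<alpha> by simp
  show ?thesis
  proof (cases "ats_delta \<phi> dh dc y > dh \<or> norm y \<le> trunc_radius")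
    case True
    then have "ats_coef \<phi> K \<gamma> dh dc f y = f y" "ats_coef \<phi> K \<gamma> dh dc g y = g y"
      by (auto simp: ats_coef_def ats_proj_eq)
    then show ?thesis using kh2[of y] v by simp
  next
    case False
    define R where "R = trunc_radius"
    define x where "x = (R / norm y) *\<^sub>R y"
    define c where "c = norm y / R"
    have R: "R \<ge> 1" "R < norm y" using trunc_radius(1) False by (auto simp: R_def)
    have coef: "ats_coef \<phi> K \<gamma> dh dc f y = f x" "ats_coef \<phi> K \<gamma> dh dc g y = g x"
      using False by (auto simp: ats_coef_def ats_proj_eq x_def R_def)
    have "y \<noteq> 0" using R by auto
    then have y: "y = c *\<^sub>R x" using R by (auto simp: x_def c_def)
    have c: "c \<ge> 1" using R by (simp add: c_def)
    have nx: "norm x = R" using R \<open>y \<noteq> 0\<close> by (simp add: x_def)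
    have "1 * ((p - 1) * (norm (g x))\<^sup>2) \<le> c * ((p - 1) * (norm (g x))\<^sup>2)"
      using c p by (intro mult_right_mono) auto
    moreover have "inner y (f x) = c * inner x (f x)" by (subst y) simp
    ultimately have "2 * inner y (f x) + (p - 1) * (norm (g x))\<^sup>2 \<le> c * (2 * inner x (f x) + (p - 1) * (norm (g x))\<^sup>2)"
      by (simp add: algebra_simps)
    also have "\<dots> \<le> c * (2 * \<alpha> * (1 + R\<^sup>2))" using kh2[of x] c unfolding nx by (intro mult_left_mono) auto
    also have "\<dots> = 2 * \<alpha> * (norm y / R + norm y * R)" using R by (simp add: c_def field_simps power2_eq_square)
    also have "\<dots> \<le> 2 * \<alpha> * (2 * (1 + (norm y)\<^sup>2))"
    proof (intro mult_left_mono)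
      have "norm y / R \<le> norm y" using R by (simp add: divide_le_eq mult_le_cancel_left1)
      moreover have "norm y * R \<le> norm y * norm y" using R by (intro mult_left_mono) auto
      moreover have "norm y * 1 \<le> norm y * norm y" using R by (intro mult_left_mono) auto
      ultimately show "norm y / R + norm y * R \<le> 2 * (1 + (norm y)\<^sup>2)" by (simp add: power2_eq_square)
    qed (use \<alpha> in auto)
    finally show ?thesis using coef by (simp add: algebra_simps)
  qed
qed

end

end

section \<open>The moment bound, uniform in the step sizes\<close>

theorem theorem3p1:
  fixes f :: "real^'d \<Rightarrow> real^'d" and g :: "real^'d \<Rightarrow> real^'m^'d" and x0 :: "real^'d"
    and p \<alpha> T \<rho> K \<gamma> :: real and \<phi> :: "real \<Rightarrow> real"
  assumes loc_lip: "\<forall>R>0. \<exists>C>0. \<forall>x y. norm x \<le> R \<and> norm y \<le> R \<longrightarrow>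
                       norm (f x - f y) + norm (g x - g y) \<le> C * norm (x - y)"
    and p_ge: "p \<ge> 2" and alpha_ge: "\<alpha> \<ge> 0"
    and khasminskii: "\<forall>x. inner x (f x) + (p - 1) / 2 * (norm (g x))\<^sup>2 \<le> \<alpha> * (1 + (norm x)\<^sup>2)"
    and phi_mono: "strict_mono_on {0..} \<phi>" and phi_cont: "continuous_on {0..} \<phi>"
    and phi_ge1: "\<forall>r\<ge>0. \<phi> r \<ge> 1" and phi_lim: "filterlim \<phi> at_top at_top"
    and phi_bound: "\<forall>r>0. \<forall>x. norm x \<le> r \<longrightarrow>
                       norm (f x) / (1 + norm x) \<le> \<phi> r \<and> (norm (g x))\<^sup>2 / (1 + norm x)\<^sup>2 \<le> \<phi> r"
    and gamma_pos: "0 < \<gamma>" and gamma_le: "\<gamma> \<le> 1/3" and K_ge: "K \<ge> \<phi> 1"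
    and T_pos: "T > 0" and rho_ge: "\<rho> \<ge> 1"
  shows "\<exists>C>0. \<forall>(M :: 'a measure) (F :: real \<Rightarrow> 'a measure) (W :: real \<Rightarrow> 'a \<Rightarrow> real^'m) dc.
           brownian_motion M F W \<and> 0 < dc \<and> dc \<le> 1 \<longrightarrow>
           (\<forall>t\<in>{0..T}.
              (\<integral>\<^sup>+ \<omega>. ennreal (norm (ats_Ybar (ats_delta \<phi> (dc / \<rho>) dc)
                   (ats_coef \<phi> K \<gamma> (dc / \<rho>) dc f) (ats_coef \<phi> K \<gamma> (dc / \<rho>) dc g) x0 W t \<omega>) powr p) \<partial>M)
                 \<le> ennreal C \<and>
              (\<integral>\<^sup>+ \<omega>. ennreal (norm (ats_Y (ats_delta \<phi> (dc / \<rho>) dc)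
                   (ats_coef \<phi> K \<gamma> (dc / \<rho>) dc f) (ats_coef \<phi> K \<gamma> (dc / \<rho>) dc g) x0 W t \<omega>) powr p) \<partial>M)
                 \<le> ennreal C)"
proof -
  have K1: "K \<ge> 1" using K_ge phi_ge1 by (metis order_trans zero_le_one)
  define \<kappa> where "\<kappa> = K + \<rho>"
  \<comment> \<open>The factor 2 comes from \<open>1 + |y| \<le> 2 * sqrt (1 + |y|\<^sup>2)\<close>.
    For the diffusion coefficient the bound \<open>4 * \<kappa>\<close> is enlarged to
    \<open>L\<^sup>2\<close>, using \<open>\<kappa> \<ge> 1\<close>.\<close>
  define L where "L = 2 * \<kappa>"
  have \<kappa>: "\<kappa> \<ge> 1" and L: "L \<ge> 1" using K1 rho_ge by (auto simp: \<kappa>_def L_def)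
  have A: "2 * \<alpha> \<ge> 0" using alpha_ge by simp
  define V where "V = (\<lambda>y :: real^'d. (1 + (norm y)\<^sup>2) powr (p / 2))"
  \<comment> \<open>The rate is fixed here, before the probability space, the Brownian motion and
    \<open>dc\<close> are introduced; this makes the final constant uniform in all of them.\<close>
  obtain lam :: real where lam: "lam \<ge> 0"
    and step: "\<And>\<theta> u y a (B :: real^'m^'d). 0 < \<theta> \<Longrightarrow> \<theta> \<le> 1 \<Longrightarrow> u = \<theta> ^ 3 \<Longrightarrow>
       \<theta> * norm a \<le> L * sqrt (1 + (norm y)\<^sup>2) \<Longrightarrow>
       \<theta> * (norm B)\<^sup>2 \<le> L\<^sup>2 * (1 + (norm y)\<^sup>2) \<Longrightarrow>
       2 * inner y a + (p - 1) * (norm B)\<^sup>2 \<le> 2 * (2 * \<alpha>) * (1 + (norm y)\<^sup>2) \<Longrightarrow>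
       (\<integral>\<^sup>+ z. ennreal (V (y + u *\<^sub>R a + B *v z)) \<partial>iso_gauss u) \<le> ennreal ((1 + lam * u) * V y)"
    unfolding V_def using iso_gauss_one_step[OF p_ge L A] by blast
  have v_nz: "1 + (norm y)\<^sup>2 \<noteq> 0" for y :: "real^'d"
    using add_pos_nonneg[OF zero_less_one zero_le_power2[of "norm y"]] by linarith
  have V_cont: "continuous_on UNIV V"
    unfolding V_def using v_nz by (intro continuous_intros) auto
  have V_pos: "V y > 0" for y using v_nz[of y] by (simp add: V_def)
  have V_ge: "norm y powr p \<le> V y" for y
  proof -
    have "norm y powr p = ((norm y)\<^sup>2) powr (p / 2)"
      by (cases "y = 0") (auto simp: powr_powr simp flip: powr_numeral)
    also have "\<dots> \<le> V y" unfolding V_def using p_ge by (intro powr_mono2) auto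
    finally show ?thesis .
  qed
  have "continuous_on UNIV f" "continuous_on UNIV g"
  proof -
    have lip: "\<exists>C>0. \<forall>x y. norm x \<le> R \<and> norm y \<le> R \<longrightarrow>
        norm (f x - f y) \<le> C * norm (x - y) \<and> norm (g x - g y) \<le> C * norm (x - y)" if R: "R > 0" for R
    proof -
      obtain C where C: "C > 0" "\<And>x y. norm x \<le> R \<and> norm y \<le> R \<Longrightarrow>
          norm (f x - f y) + norm (g x - g y) \<le> C * norm (x - y)"
        using loc_lip R by blast
      have "norm (f x - f y) \<le> C * norm (x - y) \<and> norm (g x - g y) \<le> C * norm (x - y)"
        if "norm x \<le> R \<and> norm y \<le> R" for x y
        using C(2)[OF that] norm_ge_zero[of "f x - f y"] norm_ge_zero[of "g x - g y"] by linarith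
      then show ?thesis using C(1) by blast
    qed
    show "continuous_on UNIV f" by (rule local_lipschitz_imp_continuous) (use lip in meson)
    show "continuous_on UNIV g" by (rule local_lipschitz_imp_continuous) (use lip in meson)
  qed
  then have f_meas: "f \<in> borel_measurable borel" and g_meas: "g \<in> borel_measurable borel"
    by (auto intro: borel_measurable_continuous_onI)
  define C where "C = exp (lam * T) * V x0"
  have "C > 0" using V_pos by (simp add: C_def)
  moreover have "(\<integral>\<^sup>+ \<omega>. ennreal (norm (ats_Ybar (ats_delta \<phi> (dc / \<rho>) dc)
            (ats_coef \<phi> K \<gamma> (dc / \<rho>) dc f) (ats_coef \<phi> K \<gamma> (dc / \<rho>) dc g) x0 W t \<omega>) powr p) \<partial>M) \<le> ennreal C \<and>
      (\<integral>\<^sup>+ \<omega>. ennreal (norm (ats_Y (ats_delta \<phi> (dc / \<rho>) dc)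
            (ats_coef \<phi> K \<gamma> (dc / \<rho>) dc f) (ats_coef \<phi> K \<gamma> (dc / \<rho>) dc g) x0 W t \<omega>) powr p) \<partial>M) \<le> ennreal C"
    if bm: "brownian_motion M F W" and dc: "0 < dc" "dc \<le> 1" and t: "t \<in> {0..T}"
    for M :: "'a measure" and F :: "real \<Rightarrow> 'a measure" and W :: "real \<Rightarrow> 'a \<Rightarrow> real^'m" and dc t
  proof -
    let ?\<Delta> = "ats_delta \<phi> (dc / \<rho>) dc :: real^'d \<Rightarrow> real"
    let ?F = "ats_coef \<phi> K \<gamma> (dc / \<rho>) dc f" and ?G = "ats_coef \<phi> K \<gamma> (dc / \<rho>) dc g"
    \<comment> \<open>The final \<open>refl\<close> supplies the equation
      \<open>dh = dc / \<rho>\<close> and thereby instantiates \<open>dh\<close>.\<close>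
    note ctx = phi_mono phi_cont phi_ge1 phi_lim gamma_pos gamma_le K_ge rho_ge dc refl
    have one_step: "(\<integral>\<^sup>+ z. ennreal (V (y + u *\<^sub>R ?F y + ?G y *v z)) \<partial>iso_gauss u) \<le> ennreal ((1 + lam * u) * V y)"
      if u: "0 < u" "u \<le> ?\<Delta> y" for y u
    \<comment> \<open>The one-step estimate is applied with
      \<open>\<theta> = root 3 u\<close>.\<close>
    proof (rule step)
      let ?v = "sqrt (1 + (norm y)\<^sup>2)"
      show "0 < root 3 u" "root 3 u \<le> 1" "u = root 3 u ^ 3"
        using u ats_delta_bounds(2)[OF ctx, of y] by auto
      have "1 \<le> ?v" "norm y \<le> ?v" by (auto intro: real_le_rsqrt)
      then have v: "1 + norm y \<le> 2 * ?v" by linarith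
      have "root 3 u * norm (?F y) \<le> \<kappa> * (1 + norm y)"
        unfolding \<kappa>_def by (rule ats_coef_growth(1)[OF ctx phi_bound u])
      also have "\<dots> \<le> \<kappa> * (2 * ?v)" using v \<kappa> by (intro mult_left_mono) auto
      finally show "root 3 u * norm (?F y) \<le> L * ?v" by (simp add: L_def mult_ac)
      have "root 3 u * (norm (?G y))\<^sup>2 \<le> \<kappa> * (1 + norm y)\<^sup>2"
        unfolding \<kappa>_def by (rule ats_coef_growth(2)[OF ctx phi_bound u])
      also have "\<dots> \<le> \<kappa>\<^sup>2 * (2 * ?v)\<^sup>2"
        using v \<kappa> by (intro mult_mono power_mono) (auto simp: power2_eq_square)
      finally show "root 3 u * (norm (?G y))\<^sup>2 \<le> L\<^sup>2 * (1 + (norm y)\<^sup>2)"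
        by (simp add: L_def power_mult_distrib algebra_simps)
      show "2 * inner y (?F y) + (p - 1) * (norm (?G y))\<^sup>2 \<le> 2 * (2 * \<alpha>) * (1 + (norm y)\<^sup>2)"
        by (rule ats_coef_khasminskii[OF ctx phi_bound p_ge alpha_ge]) (use khasminskii in blast)
    qed
    note bound = ats_moment_bound[OF bm ats_delta_measurable[OF ctx] ats_coef_measurable[OF ctx f_meas]
      ats_coef_measurable[OF ctx g_meas] dh_bounds(1)[OF ctx] ats_delta_bounds(1)[OF ctx] _ lam V_cont less_imp_le[OF V_pos] one_step,
      where t = t and ?x0.0 = x0]
    have "exp (lam * t) * V x0 \<le> C" using t lam V_pos[of x0] by (simp add: C_def mult_left_mono)
    then have C: "ennreal (exp (lam * t) * V x0) \<le> ennreal C" by (rule ennreal_leI)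
    have mono: "(\<integral>\<^sup>+ \<omega>. ennreal (norm (Z \<omega>) powr p) \<partial>M) \<le> (\<integral>\<^sup>+ \<omega>. ennreal (V (Z \<omega>)) \<partial>M)" for Z
      by (intro nn_integral_mono ennreal_leI V_ge)
    show ?thesis
      using t by (intro conjI order_trans[OF mono order_trans[OF bound(1) C]] order_trans[OF mono order_trans[OF bound(2) C]]) auto
  qed
  ultimately show ?thesis by (intro exI[of _ C]) blast
qed

end
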